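(* Let $\mathcal{H}_A,\mathcal{H}_B$ be finite-dimensional Hilbert spaces, $\rho_{AB}\in\mathcal{S}(\mathcal{H}_{AB})$, $\sigma_B\in\mathcal{S}(\mathcal{H}_B)$, $\varepsilon>0$ and $\alpha\in(1,2]$. Then $$H_{\min}^{\varepsilon}(A|B)_{\rho|\sigma}\ \ge\ H_\alpha(A|B)_{\rho|\sigma}-\frac{1}{\alpha-1}\log\frac{2}{\varepsilon^2}.$$
   Context: All Hilbert spaces are finite-dimensional; $\log$ is the binary logarithm. For a Hilbert space $\mathcal{H}$, $\mathcal{S}(\mathcal{H})$ denotes the positive semi-definite operators of trace $1$ and $\mathcal{S}_{\le}(\mathcal{H})$ those of trace at most $1$. Write $\mathcal{H}_{AB}=\mathcal{H}_A\otimes\mathcal{H}_B$. $\mathbb{1}$ denotes an identity operator. Entropies take values in the extended reals. $\alpha$-entropy: for $\rho_{AB}\in\mathcal{S}(\mathcal{H}_{AB})$, $\sigma_B\in\mathcal{S}(\mathcal{H}_B)$, $\alpha\in(0,1)\cup(1,\infty)$, $H_\alpha(A|B)_{\rho|\sigma}:=\frac{1}{1-\alpha}\log\mathrm{tr}\big(\rho_{AB}^\alpha(\mathbb{1}_A\otimes\sigma_B)^{1-\alpha}\big)$ if $\sigma_B$ is invertible, and otherwise the limit as $\xi\to0^+$ of the same expression with $\sigma_B$ replaced by $\sigma_B+\xi\mathbb{1}_B$ (for $\alpha>1$ this limit is $-\infty$ unless $\mathrm{supp}\,\sigma_B\supseteq\mathrm{supp}\,\rho_B$). Min-entropy: for $\rho_{AB}\in\mathcal{S}_\le(\mathcal{H}_{AB})$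 and $\sigma_B\in\mathcal{S}(\mathcal{H}_B)$, $H_{\min}(A|B)_{\rho|\sigma}:=\sup\{\lambda\in\mathbb{R}:2^{-\lambda}\,\mathbb{1}_A\otimes\sigma_B\ge\rho_{AB}\}$ (equal to $-\infty$ if no such $\lambda$ exists, and $+\infty$ if $\rho_{AB}=0$). Smoothing: for $\varepsilon>0$ and $\rho\in\mathcal{S}(\mathcal{H})$, $\mathcal{B}^\varepsilon(\rho):=\{\tilde\rho\in\mathcal{S}_\le(\mathcal{H}):C(\rho,\tilde\rho)\le\varepsilon\}$ with $C(\rho,\tilde\rho):=\sqrt{1-F^2(\rho,\tilde\rho)}$ and $F(\rho,\tilde\rho):=\mathrm{tr}|\sqrt\rho\sqrt{\tilde\rho}|$. Then $H_{\min}^\varepsilon(A|B)_{\rho|\sigma}:=\max_{\tilde\rho_{AB}\in\mathcal{B}^\varepsilon(\rho_{AB})}H_{\min}(A|B)_{\tilde\rho|\sigma}$. *)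

theory Defs
  imports "HOL-Analysis.Analysis"
begin

(* Operators on the Hilbert space with orthonormal basis indexed by the finite type 'n.
   The tensor product of the spaces over 'a and 'b is the space over 'a \<times> 'b. *)
type_synonym 'n cmatrix = "((complex, 'n) vec, 'n) vec"

definition cadjoint :: "'n::finite cmatrix \<Rightarrow> 'n cmatrix" where
  "cadjoint A = (\<chi> i j. cnj (A $ j $ i))"

definition hermitian :: "'n::finite cmatrix \<Rightarrow> bool" where
  "hermitian A \<longleftrightarrow> cadjoint A = A"

definition unitary :: "'n::finite cmatrix \<Rightarrow> bool" where
  "unitary U \<longleftrightarrow> cadjoint U ** U = mat 1 \<and> U ** cadjoint U = mat 1"

(* The real inner product of the library on complex vectors is the real part of the
   Hermitian inner product, and the latter is real here because A is Hermitian. *)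
definition psd :: "'n::finite cmatrix \<Rightarrow> bool" where
  "psd A \<longleftrightarrow> hermitian A \<and> (\<forall>v. 0 \<le> v \<bullet> (A *v v))"

definition loewner_le :: "'n::finite cmatrix \<Rightarrow> 'n cmatrix \<Rightarrow> bool" where
  "loewner_le A B \<longleftrightarrow> psd (B - A)"

definition tensor :: "'a::finite cmatrix \<Rightarrow> 'b::finite cmatrix \<Rightarrow> ('a \<times> 'b) cmatrix" where
  "tensor A B = (\<chi> i j. A $ fst i $ fst j * B $ snd i $ snd j)"

definition diag_real :: "('n::finite \<Rightarrow> real) \<Rightarrow> 'n cmatrix" where
  "diag_real d = (\<chi> i j. if i = j then complex_of_real (d i) else 0)"

(* Functional calculus for Hermitian A, through any unitary diagonalisation; the result
   does not depend on the choice, see herm_fun_eqI below. *)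
definition herm_fun :: "(real \<Rightarrow> real) \<Rightarrow> 'n::finite cmatrix \<Rightarrow> 'n cmatrix" where
  "herm_fun f A = (THE X. \<exists>U d. unitary U \<and> A = U ** diag_real d ** cadjoint U \<and>
      X = U ** diag_real (\<lambda>i. f (d i)) ** cadjoint U)"

(* Since 0 powr a = 0, this is the power on the support when A is singular. *)
definition mat_powr :: "'n::finite cmatrix \<Rightarrow> real \<Rightarrow> 'n cmatrix" where
  "mat_powr A a = herm_fun (\<lambda>x. x powr a) A"

definition mat_sqrt :: "'n::finite cmatrix \<Rightarrow> 'n cmatrix" where
  "mat_sqrt A = herm_fun sqrt A"

definition mat_abs :: "'n::finite cmatrix \<Rightarrow> 'n cmatrix" where
  "mat_abs X = mat_sqrt (cadjoint X ** X)"

definition states :: "'n::finite cmatrix set" where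
  "states = {\<rho>. psd \<rho> \<and> trace \<rho> = 1}"

definition substates :: "'n::finite cmatrix set" where
  "substates = {\<rho>. psd \<rho> \<and> Re (trace \<rho>) \<le> 1}"

definition alpha_expr :: "real \<Rightarrow> ('a::finite \<times> 'b::finite) cmatrix \<Rightarrow> 'b cmatrix \<Rightarrow> real" where
  "alpha_expr \<alpha> \<rho> \<sigma> = 1 / (1 - \<alpha>) *
     log 2 (Re (trace (mat_powr \<rho> \<alpha> ** mat_powr (tensor (mat 1) \<sigma>) (1 - \<alpha>))))"

definition alpha_entropy :: "real \<Rightarrow> ('a::finite \<times> 'b::finite) cmatrix \<Rightarrow> 'b cmatrix \<Rightarrow> ereal" where
  "alpha_entropy \<alpha> \<rho> \<sigma> =
     (if invertible \<sigma> then ereal (alpha_expr \<alpha> \<rho> \<sigma>)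
      else Lim (at_right 0) (\<lambda>\<xi>. ereal (alpha_expr \<alpha> \<rho> (\<sigma> + \<xi> *\<^sub>R mat 1))))"

definition min_entropy :: "('a::finite \<times> 'b::finite) cmatrix \<Rightarrow> 'b cmatrix \<Rightarrow> ereal" where
  "min_entropy \<rho> \<sigma> =
     Sup {ereal l | l. loewner_le \<rho> ((2 powr (- l)) *\<^sub>R tensor (mat 1) \<sigma>)}"

definition fidelity :: "'n::finite cmatrix \<Rightarrow> 'n cmatrix \<Rightarrow> real" where
  "fidelity \<rho> \<tau> = Re (trace (mat_abs (mat_sqrt \<rho> ** mat_sqrt \<tau>)))"

definition cdist :: "'n::finite cmatrix \<Rightarrow> 'n cmatrix \<Rightarrow> real" where
  "cdist \<rho> \<tau> = sqrt (1 - (fidelity \<rho> \<tau>)\<^sup>2)"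

definition eps_ball :: "real \<Rightarrow> 'n::finite cmatrix \<Rightarrow> 'n cmatrix set" where
  "eps_ball \<epsilon> \<rho> = {\<tau> \<in> substates. cdist \<rho> \<tau> \<le> \<epsilon>}"

(* A genuine maximum over the ball, not merely a supremum. *)
definition smooth_min_entropy ::
    "real \<Rightarrow> ('a::finite \<times> 'b::finite) cmatrix \<Rightarrow> 'b cmatrix \<Rightarrow> ereal" where
  "smooth_min_entropy \<epsilon> \<rho> \<sigma> =
     (GREATEST h. h \<in> (\<lambda>\<tau>. min_entropy \<tau> \<sigma>) ` eps_ball \<epsilon> \<rho>)"

lemma matrix_diag_real_nth: "((A::'n::finite cmatrix) ** diag_real d) $ i $ j = A $ i $ j * of_real (d j)"
  unfolding matrix_matrix_mult_def diag_real_def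
  by (simp add: if_distrib[of "\<lambda>x. _ * x"] cong: if_cong)

lemma diag_real_matrix_nth: "(diag_real d ** (A::'n::finite cmatrix)) $ i $ j = of_real (d i) * A $ i $ j"
  unfolding matrix_matrix_mult_def diag_real_def
  by (simp add: if_distrib[of "\<lambda>x. x * _"] cong: if_cong)

lemma herm_fun_eqI:
  fixes A U :: "'n::finite cmatrix"
  assumes U: "unitary U" and A: "A = U ** diag_real d ** cadjoint U"
  shows "herm_fun f A = U ** diag_real (\<lambda>i. f (d i)) ** cadjoint U"
  unfolding herm_fun_def
proof (rule the_equality)
  show "\<exists>V e. unitary V \<and> A = V ** diag_real e ** cadjoint V \<and>
     U ** diag_real (\<lambda>i. f (d i)) ** cadjoint U = V ** diag_real (\<lambda>i. f (e i)) ** cadjoint V"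
    using U A by blast
next
  fix X
  assume "\<exists>V e. unitary V \<and> A = V ** diag_real e ** cadjoint V \<and>
     X = V ** diag_real (\<lambda>i. f (e i)) ** cadjoint V"
  then obtain V e where V: "unitary V" and A': "A = V ** diag_real e ** cadjoint V"
    and X: "X = V ** diag_real (\<lambda>i. f (e i)) ** cadjoint V" by blast
  define W where "W = cadjoint V ** U"
  have cancel: "cadjoint U ** (U ** M) = M" "U ** (cadjoint U ** M) = M"
    "cadjoint V ** (V ** M) = M" "V ** (cadjoint V ** M) = M" for M :: "'n cmatrix"
    using U V by (simp_all add: unitary_def matrix_mul_assoc)
  have UU: "cadjoint U ** U = mat 1"
    using U by (simp add: unitary_def)
  have UU': "U ** cadjoint U = mat 1"
    using U by (simp add: unitary_def)
  have "W ** diag_real d = cadjoint V ** (U ** diag_real d ** cadjoint U) ** U"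
    by (simp add: W_def matrix_mul_assoc[symmetric] UU)
  also have "\<dots> = cadjoint V ** (V ** diag_real e ** cadjoint V) ** U"
    using A A' by simp
  also have "\<dots> = diag_real e ** W"
    by (simp add: W_def matrix_mul_assoc[symmetric] cancel)
  finally have c: "W $ i $ j * of_real (d j) = of_real (e i) * W $ i $ j" for i j
    by (metis matrix_diag_real_nth diag_real_matrix_nth)
  have "W $ i $ j * of_real (f (d j)) = of_real (f (e i)) * W $ i $ j" for i j
    using c[of i j] by (cases "W $ i $ j = 0") (auto simp: mult.commute)
  then have fc: "W ** diag_real (\<lambda>i. f (d i)) = diag_real (\<lambda>i. f (e i)) ** W"
    by (simp add: vec_eq_iff matrix_diag_real_nth diag_real_matrix_nth)
  have "X = V ** (diag_real (\<lambda>i. f (e i)) ** W) ** cadjoint U"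
    by (simp add: X W_def matrix_mul_assoc[symmetric] UU')
  also have "\<dots> = U ** diag_real (\<lambda>i. f (d i)) ** cadjoint U"
    unfolding fc[symmetric] by (simp add: W_def matrix_mul_assoc[symmetric] cancel)
  finally show "X = U ** diag_real (\<lambda>i. f (d i)) ** cadjoint U" .
qed

end

theory Submission
  imports Defs
begin

text \<open>Put \<open>B = 2\<^sup>-\<^sup>\<lambda> (1 \<otimes> \<sigma>)\<close>, let \<open>P\<close> be the projection onto the positive part \<open>\<Delta>\<close> of \<open>\<rho> - B\<close>, and
  \<open>T = \<surd>(B + \<Delta>)\<close>, so \<open>\<rho> \<le> T\<^sup>2\<close>. Write \<open>\<surd>\<rho> = T K\<close> with a contraction \<open>K\<close>, and \<open>S = \<surd>B\<close>. Then
  \<open>\<tau> = S K K\<^sup>\<dagger> S \<le> B\<close> has min-entropy at least \<open>\<lambda>\<close>, and \<open>F(\<rho>, \<tau>) \<ge> Re (tr (T S K K\<^sup>\<dagger>)) \<ge> 1 - tr \<Delta>\<close> because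
  \<open>2 T\<^sup>2 - T S - S T = \<Delta> + (T - S)\<^sup>2\<close> is positive and \<open>S \<le> T\<close>; hence \<open>C(\<rho>, \<tau>)\<^sup>2 \<le> 2 tr \<Delta>\<close>. Finally
  \<open>tr \<Delta> = tr (P (\<rho> - B)) \<le> tr (\<rho>\<^sup>\<alpha> B\<^sup>1\<^sup>-\<^sup>\<alpha>)\<close>: expand both sides over the pairs of eigenvectors of
  \<open>\<rho>\<close> and \<open>B\<close>, complete a square and use \<open>r\<^sup>2 / (r + b) \<le> r\<^sup>\<alpha> b\<^sup>1\<^sup>-\<^sup>\<alpha>\<close>, valid for \<open>1 < \<alpha> \<le> 2\<close>.\<close>

section \<open>Complex matrices\<close>

lemma cadjoint_nth [simp]: "cadjoint A $ i $ j = cnj (A $ j $ i)"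
  by (simp add: cadjoint_def)

lemma cadjoint_cadjoint [simp]: "cadjoint (cadjoint A) = A"
  by (simp add: vec_eq_iff)

lemma cadjoint_mult: "cadjoint (A ** B) = cadjoint B ** cadjoint A"
  by (simp add: vec_eq_iff matrix_matrix_mult_def mult.commute)

lemma cadjoint_add: "cadjoint (A + B) = cadjoint A + cadjoint B"
  by (simp add: vec_eq_iff)

lemma cadjoint_diff: "cadjoint (A - B) = cadjoint A - cadjoint B"
  by (simp add: vec_eq_iff)

lemma cadjoint_scaleR: "cadjoint (c *\<^sub>R A) = c *\<^sub>R cadjoint A"
  by (simp add: vec_eq_iff)

lemma cadjoint_mat_1 [simp]: "cadjoint (mat 1) = mat 1"
  by (simp add: vec_eq_iff mat_def)

lemma cadjoint_diag_real [simp]: "cadjoint (diag_real d) = diag_real d"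
  by (auto simp: vec_eq_iff diag_real_def)

lemma diag_real_mult: "diag_real d ** diag_real e = diag_real (\<lambda>i. d i * e i)"
  by (simp add: vec_eq_iff diag_real_matrix_nth) (simp add: diag_real_def)

lemma diag_real_1: "diag_real (\<lambda>i. 1) = mat 1"
  by (simp add: vec_eq_iff diag_real_def mat_def)

lemma diag_real_add: "diag_real d + diag_real e = diag_real (\<lambda>i. d i + e i)"
  by (simp add: vec_eq_iff diag_real_def)

lemma diag_real_diff: "diag_real d - diag_real e = diag_real (\<lambda>i. d i - e i)"
  by (simp add: vec_eq_iff diag_real_def)

lemma diag_real_scaleR: "c *\<^sub>R diag_real d = diag_real (\<lambda>i. c * d i)"
  unfolding vec_eq_iff vector_scaleR_component by (simp add: diag_real_def scaleR_conv_of_real)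

lemma matrix_add_rdistrib: "(A + B) ** (C::'n::finite cmatrix) = A ** C + B ** C"
  by (simp add: vec_eq_iff matrix_matrix_mult_def distrib_right sum.distrib)

lemma matrix_diff_ldistrib: "(A::'n::finite cmatrix) ** (B - C) = A ** B - A ** C"
  by (simp add: vec_eq_iff matrix_matrix_mult_def right_diff_distrib sum_subtractf)

lemma matrix_diff_rdistrib: "(A - B) ** (C::'n::finite cmatrix) = A ** C - B ** C"
  by (simp add: vec_eq_iff matrix_matrix_mult_def left_diff_distrib sum_subtractf)

lemma matrix_scaleR_left: "(c *\<^sub>R A) ** (B::'n::finite cmatrix) = c *\<^sub>R (A ** B)"
  by (simp add: vec_eq_iff matrix_matrix_mult_def scaleR_sum_right)

lemma matrix_scaleR_right: "(A::'n::finite cmatrix) ** (c *\<^sub>R B) = c *\<^sub>R (A ** B)"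
  by (simp add: vec_eq_iff matrix_matrix_mult_def scaleR_sum_right)

lemmas matrix_distribs = matrix_add_ldistrib matrix_add_rdistrib
  matrix_diff_ldistrib matrix_diff_rdistrib

lemma trace_cadjoint: "trace (cadjoint A) = cnj (trace A)"
  by (simp add: trace_def)

lemma trace_rotate: "trace ((A::'n::finite cmatrix) ** B ** C) = trace (B ** C ** A)"
  by (metis matrix_mul_assoc trace_mul_sym)

lemma trace_diag_mult: "trace (diag_real d ** A) = (\<Sum>i\<in>UNIV. of_real (d i) * A $ i $ i)"
  by (simp add: trace_def diag_real_matrix_nth)

text \<open>The phase rotations below need complex factors, while \<open>*\<^sub>R\<close> takes
  real ones.\<close>

definition cmul :: "complex \<Rightarrow> 'n::finite cmatrix \<Rightarrow> 'n cmatrix" where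
  "cmul c A = (\<chi> i j. c * A $ i $ j)"

lemma cmul_mult_left: "cmul c A ** B = cmul c (A ** B)"
  by (simp add: vec_eq_iff matrix_matrix_mult_def cmul_def sum_distrib_left mult_ac)

lemma cmul_mult_right: "A ** cmul c B = cmul c (A ** B)"
  by (simp add: vec_eq_iff matrix_matrix_mult_def cmul_def sum_distrib_left mult_ac)

lemma trace_cmul: "trace (cmul c A) = c * trace A"
  by (simp add: trace_def cmul_def sum_distrib_left)

lemma cadjoint_cmul: "cadjoint (cmul c A) = cmul (cnj c) (cadjoint A)"
  by (simp add: vec_eq_iff cmul_def)

lemma cmul_add: "cmul c (A + B) = cmul c A + cmul c B"
  by (simp add: vec_eq_iff cmul_def distrib_left)

lemma cmul_cmul: "cmul c (cmul d A) = cmul (c * d) A"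
  by (simp add: vec_eq_iff cmul_def)

section \<open>Quadratic forms of complex matrices\<close>

definition qform :: "'n::finite cmatrix \<Rightarrow> (complex, 'n) vec \<Rightarrow> complex" where
  "qform M v = (\<Sum>i\<in>UNIV. cnj (v $ i) * (M *v v) $ i)"

text \<open>The form itself is kept complex because its imaginary part detects hermiticity.\<close>

lemma Re_qform: "Re (qform M v) = v \<bullet> (M *v v)"
  by (simp add: qform_def inner_vec_def inner_complex_def)

lemma qform_cadjoint: "qform (cadjoint M) v = cnj (qform M v)"
proof -
  have "qform (cadjoint M) v = (\<Sum>i\<in>UNIV. \<Sum>j\<in>UNIV. cnj (v $ i) * (cnj (M $ j $ i) * v $ j))"
    by (simp add: qform_def matrix_vector_mult_def sum_distrib_left)
  also have "\<dots> = (\<Sum>j\<in>UNIV. \<Sum>i\<in>UNIV. cnj (v $ i) * (cnj (M $ j $ i) * v $ j))"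
    by (rule sum.swap)
  also have "\<dots> = cnj (qform M v)"
    by (simp add: qform_def matrix_vector_mult_def sum_distrib_left mult_ac)
  finally show ?thesis .
qed

lemma qform_diff: "qform (A - B) v = qform A v - qform B v"
  by (simp add: qform_def matrix_vector_mult_diff_rdistrib right_diff_distrib sum_subtractf)

lemma qform_scale: "qform M (c *s v) = (cmod c)\<^sup>2 * qform M v"
proof -
  have "M *v (c *s v) = c *s (M *v v)"
    by (simp add: vec_eq_iff matrix_vector_mult_def sum_distrib_left mult_ac)
  then have "qform M (c *s v) = (c * cnj c) * qform M v"
    by (simp add: qform_def sum_distrib_left mult_ac)
  then show ?thesis by (simp only: complex_norm_square)
qed

lemma qform_axis2:
  assumes "i \<noteq> j"
  shows "qform M (axis i 1 + axis j c) =
    M $ i $ i + cnj c * c * M $ j $ j + c * M $ i $ j + cnj c * M $ j $ i"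
proof -
  let ?v = "axis i 1 + axis j c"
  have v: "?v $ k = (if k = i then 1 else 0) + (if k = j then c else 0)" for k
    by (auto simp: axis_def)
  have m: "(M *v ?v) $ k = M $ k $ i + c * M $ k $ j" for k
    by (simp add: matrix_vector_mult_def v distrib_left sum.distrib if_distrib[of "\<lambda>x. _ * x"] mult.commute
        del: vector_add_component cong: if_cong)
  have "qform M ?v = (\<Sum>k\<in>UNIV. (if k = i then (M *v ?v) $ k else 0)
      + (if k = j then cnj c * (M *v ?v) $ k else 0))"
    unfolding qform_def by (rule sum.cong) (auto simp: v distrib_right simp del: vector_add_component)
  then show ?thesis
    by (simp add: sum.distrib m distrib_left mult_ac add_ac)
qed

lemma qform_axis: "qform M (axis i 1) = M $ i $ i"
proof -
  have "qform M (axis i 1) = (\<Sum>k\<in>UNIV. if k = i then M $ i $ i else 0)"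
    unfolding qform_def by (rule sum.cong) (auto simp: axis_def matrix_vector_mult_def if_distrib cong: if_cong)
  then show ?thesis by simp
qed

text \<open>Basis vectors show that the diagonal vanishes; \<open>axis i 1 + axis j c\<close> with
  \<open>c = 1\<close> and \<open>c = \<i>\<close> then controls the sum and the difference of the
  two off-diagonal entries.\<close>

lemma qform_zero_imp:
  assumes "\<And>v. qform M v = 0"
  shows "M = 0"
proof -
  have d: "M $ i $ i = 0" for i using assms[of "axis i 1"] by (simp add: qform_axis)
  have "M $ i $ j = 0" for i j
  proof (cases "i = j")
    case False
    have "M $ i $ j + M $ j $ i = 0" "\<i> * M $ i $ j - \<i> * M $ j $ i = 0"
      using assms[of "axis i 1 + axis j 1"] assms[of "axis i 1 + axis j \<i>"] False d
      by (simp_all add: qform_axis2)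
    then show ?thesis by (simp add: right_diff_distrib[symmetric] eq_neg_iff_add_eq_0[symmetric])
  qed (simp add: d)
  then show ?thesis by (simp add: vec_eq_iff)
qed

text \<open>Scaling reduces claims about the form to unit vectors, the case that
  \<open>unitary_phase\<close> treats; at \<open>v = 0\<close> any unit vector serves.\<close>

lemma qform_unit_vector:
  obtains w where "norm w = 1" "qform M v = (norm v)\<^sup>2 * qform M w"
proof (cases "v = 0")
  case True
  have "qform M 0 = 0" by (simp add: qform_def)
  moreover obtain k :: 'a where True by simp
  ultimately show ?thesis using True that[of "axis k 1"] by (simp add: norm_axis_1)
next
  case False
  define c where "c = complex_of_real (1 / norm v)"
  have "norm (c *s v) = 1"
  proof -
    have "c *s v = (1 / norm v) *\<^sub>R v"
      unfolding vec_eq_iff vector_scaleR_component by (simp add: c_def scaleR_conv_of_real)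
    then show ?thesis using False by simp
  qed
  moreover have "qform M v = (norm v)\<^sup>2 * qform M (c *s v)"
    using False by (simp add: qform_scale c_def norm_divide power_divide)
  ultimately show ?thesis using that by blast
qed

text \<open>A real form agrees with that of the adjoint, and over the complex numbers the form
  determines the matrix.\<close>

lemma hermitian_if_qform_real:
  assumes "\<And>v. norm v = 1 \<Longrightarrow> Im (qform M v) = 0"
  shows "hermitian M"
proof -
  have "Im (qform M v) = 0" for v
  proof -
    obtain w where "norm w = 1" "qform M v = (norm v)\<^sup>2 * qform M w"
      by (rule qform_unit_vector)
    with assms[of w] show ?thesis
      by (metis Im_complex_of_real Re_complex_of_real complex_eq_iff complex_is_Real_iff
        of_real_Re of_real_mult)
  qed
  then have "qform (cadjoint M - M) v = 0" for v
    by (simp add: qform_diff qform_cadjoint complex_eq_iff)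
  then show ?thesis
    using qform_zero_imp[of "cadjoint M - M"] by (simp add: hermitian_def)
qed

lemma psd_if_qform:
  assumes "\<And>v. norm v = 1 \<Longrightarrow> Im (qform M v) = 0 \<and> 0 \<le> Re (qform M v)"
  shows "psd M"
  unfolding psd_def
proof (intro conjI allI)
  show "hermitian M" using assms by (blast intro: hermitian_if_qform_real)
  fix v
  obtain w where "norm w = 1" "qform M v = (norm v)\<^sup>2 * qform M w"
    by (rule qform_unit_vector)
  with assms[of w] show "0 \<le> v \<bullet> (M *v v)"
    unfolding Re_qform[symmetric] by (simp flip: of_real_power)
qed

section \<open>Real inner products of vectors and matrices\<close>

lemma inner_mult_vec: "x \<bullet> (A *v y) = (cadjoint A *v x) \<bullet> (y :: (complex, 'n::finite) vec)"
proof -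
  have "x \<bullet> (A *v y) = (\<Sum>i\<in>UNIV. \<Sum>j\<in>UNIV. Re (cnj (x $ i) * A $ i $ j * y $ j))"
    by (simp add: inner_vec_def inner_complex_def matrix_vector_mult_def sum_distrib_left
        sum.distrib algebra_simps flip: sum.distrib)
  also have "\<dots> = (\<Sum>j\<in>UNIV. \<Sum>i\<in>UNIV. Re (cnj (x $ i) * A $ i $ j * y $ j))"
    by (rule sum.swap)
  also have "\<dots> = (cadjoint A *v x) \<bullet> y"
    by (simp add: inner_vec_def inner_complex_def matrix_vector_mult_def sum_distrib_right
        sum_distrib_left sum.distrib algebra_simps sum_subtractf sum_negf flip: sum.distrib)
  finally show ?thesis .
qed

text \<open>The real Hilbert-Schmidt product: it makes \<open>norm\<close> the Frobenius norm, which
  later bounds the unitary group and the set behind the smoothing ball.\<close>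

lemma inner_matrix: "A \<bullet> B = Re (trace (cadjoint A ** (B :: 'n::finite cmatrix)))"
proof -
  have "A \<bullet> B = (\<Sum>i\<in>UNIV. \<Sum>j\<in>UNIV. Re (cnj (A $ i $ j) * B $ i $ j))"
    by (simp add: inner_vec_def inner_complex_def)
  also have "\<dots> = (\<Sum>j\<in>UNIV. \<Sum>i\<in>UNIV. Re (cnj (A $ i $ j) * B $ i $ j))"
    by (rule sum.swap)
  also have "\<dots> = Re (trace (cadjoint A ** B))"
    by (simp add: trace_def matrix_matrix_mult_def)
  finally show ?thesis .
qed

lemma norm_matrix_power2: "(norm A)\<^sup>2 = Re (trace (cadjoint A ** (A :: 'n::finite cmatrix)))"
  by (simp add: power2_norm_eq_inner inner_matrix)

section \<open>Continuity of matrix operations\<close>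

lemma continuous_on_matrix_mult [continuous_intros]:
  fixes f g :: "'a::topological_space \<Rightarrow> 'n::finite cmatrix"
  assumes "continuous_on S f" "continuous_on S g"
  shows "continuous_on S (\<lambda>x. f x ** g x)"
  unfolding matrix_matrix_mult_def using assms by (intro continuous_intros)

lemma continuous_on_cadjoint [continuous_intros]:
  fixes f :: "'a::topological_space \<Rightarrow> 'n::finite cmatrix"
  assumes "continuous_on S f"
  shows "continuous_on S (\<lambda>x. cadjoint (f x))"
  unfolding cadjoint_def using assms by (intro continuous_intros)

lemma continuous_on_trace [continuous_intros]:
  fixes f :: "'a::topological_space \<Rightarrow> 'n::finite cmatrix"
  assumes "continuous_on S f"
  shows "continuous_on S (\<lambda>x. trace (f x))"
  unfolding trace_def using assms by (intro continuous_intros)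

lemma continuous_on_matrix_vector_mult [continuous_intros]:
  fixes f :: "'a::topological_space \<Rightarrow> 'n::finite cmatrix"
  assumes "continuous_on S f"
  shows "continuous_on S (\<lambda>x. f x *v v)"
  unfolding matrix_vector_mult_def using assms by (intro continuous_intros)

section \<open>Unitary matrices and the spectral theorem\<close>

lemma unitary_cadjoint: "unitary U \<Longrightarrow> unitary (cadjoint U)"
  by (simp add: unitary_def)

lemma unitary_mat_1: "unitary (mat 1)"
  by (simp add: unitary_def)

lemma unitary_mult: "unitary U \<Longrightarrow> unitary V \<Longrightarrow> unitary (U ** V)"
  unfolding unitary_def cadjoint_mult
  by (metis matrix_mul_assoc matrix_mul_rid)

lemma unitary_cancel:
  assumes "unitary U"
  shows "cadjoint U ** (U ** M) = M" "U ** (cadjoint U ** M) = M"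
  using assms by (simp_all add: unitary_def matrix_mul_assoc)

lemma unitary_self: "unitary U \<Longrightarrow> cadjoint U ** U = mat 1" "unitary U \<Longrightarrow> U ** cadjoint U = mat 1"
  by (simp_all add: unitary_def)

text \<open>Continuous equations cut out a closed set, and every unitary matrix has squared
  Frobenius norm equal to the dimension.\<close>

lemma compact_unitary: "compact (Collect unitary :: 'n::finite cmatrix set)"
proof -
  have "closed (Collect unitary :: 'n cmatrix set)"
    unfolding unitary_def by (intro closed_Collect_conj closed_Collect_eq continuous_intros)
  moreover have "norm (U :: 'n cmatrix) = sqrt (Re (trace (mat 1 :: 'n cmatrix)))" if "unitary U" for U
    using that norm_matrix_power2[of U] by (simp add: unitary_self real_sqrt_unique)
  then have "bounded (Collect unitary :: 'n cmatrix set)"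
    unfolding bounded_iff by auto
  ultimately show ?thesis by (simp add: compact_eq_bounded_closed)
qed

section \<open>Rank-one matrices and phase rotations\<close>

definition rank1 :: "(complex, 'n::finite) vec \<Rightarrow> 'n cmatrix" where
  "rank1 v = (\<chi> i j. v $ i * cnj (v $ j))"

lemma trace_mult_rank1: "trace (M ** rank1 v) = qform M v"
  by (simp add: trace_def rank1_def qform_def matrix_matrix_mult_def matrix_vector_mult_def
      sum_distrib_left sum_distrib_right mult_ac)

lemma cadjoint_rank1 [simp]: "cadjoint (rank1 v) = rank1 v"
  by (simp add: vec_eq_iff rank1_def)

lemma rank1_mult_self:
  assumes "norm v = 1"
  shows "rank1 v ** rank1 v = rank1 v"
proof -
  have "(\<Sum>k\<in>UNIV. cnj (v $ k) * v $ k) = of_real (v \<bullet> v)"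
    by (simp add: complex_eq_iff inner_vec_def inner_complex_def)
  also have "v \<bullet> v = 1" using assms by (simp add: norm_eq_1)
  finally have 1: "(\<Sum>k\<in>UNIV. cnj (v $ k) * v $ k) = 1" by simp
  have "(\<Sum>k\<in>UNIV. v $ i * cnj (v $ k) * (v $ k * cnj (v $ j)))
      = v $ i * (\<Sum>k\<in>UNIV. cnj (v $ k) * v $ k) * cnj (v $ j)" for i j
    by (simp add: sum_distrib_left sum_distrib_right mult_ac)
  then show ?thesis
    by (simp add: vec_eq_iff rank1_def matrix_matrix_mult_def 1)
qed

text \<open>For a unit vector \<open>v\<close> this multiplies \<open>v\<close> by \<open>z\<close>
  and fixes its orthogonal complement. These rotations are the variations tested at maximisers over
  the unitary group.\<close>

definition phase :: "complex \<Rightarrow> (complex, 'n::finite) vec \<Rightarrow> 'n cmatrix" where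
  "phase z v = mat 1 + cmul (z - 1) (rank1 v)"

lemma cadjoint_phase: "cadjoint (phase z v) = phase (cnj z) v"
  by (simp add: phase_def cadjoint_add cadjoint_cmul)

lemma unitary_phase:
  assumes v: "norm v = 1" and z: "cmod z = 1"
  shows "unitary (phase z v)"
proof -
  have "phase w v ** phase w' v = mat 1" if "w * w' = 1" for w w'
  proof -
    have "phase w v ** phase w' v = mat 1 + (cmul (w - 1) (rank1 v) + cmul (w' - 1) (rank1 v)
        + cmul ((w - 1) * (w' - 1)) (rank1 v))"
      unfolding phase_def
      by (simp add: matrix_distribs cmul_mult_left cmul_mult_right cmul_cmul cmul_add
          rank1_mult_self[OF v] mult.commute)
    also have "cmul (w - 1) (rank1 v) + cmul (w' - 1) (rank1 v)
        + cmul ((w - 1) * (w' - 1)) (rank1 v) = cmul (w * w' - 1) (rank1 v)"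
      by (simp add: vec_eq_iff cmul_def algebra_simps)
    also have "\<dots> = 0" using that by (simp add: vec_eq_iff cmul_def)
    finally show ?thesis by simp
  qed
  moreover have "z * cnj z = 1" "cnj z * z = 1"
    using complex_norm_square[of z] z by (simp_all add: mult.commute)
  ultimately show ?thesis by (simp add: unitary_def cadjoint_phase)
qed

text \<open>At a maximiser \<open>U\<close> of \<open>Re (tr (D U\<^sup>\<dagger> A U))\<close> over the unitary group, \<open>D\<close> a diagonal with distinct
  entries, the first variation along the phases forces \<open>D B\<close>, \<open>B = U\<^sup>\<dagger> A U\<close>, to be Hermitian;
  then \<open>D\<close> commutes with \<open>B\<close>, so \<open>B\<close> is diagonal.\<close>
theorem spectral:
  fixes A :: "'n::finite cmatrix"
  assumes A: "hermitian A"
  obtains U d where "unitary U" "A = U ** diag_real d ** cadjoint U"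
proof -
  obtain k :: "'n \<Rightarrow> nat" where k: "inj k"
    using finite_imp_inj_to_nat_seg[of "UNIV :: 'n set"] by auto
  define D where "D = diag_real (\<lambda>i. real (k i))"
  let ?f = "\<lambda>U. Re (trace (D ** (cadjoint U ** A ** U)))"
  have "\<exists>U\<in>Collect unitary. \<forall>V\<in>Collect unitary. ?f V \<le> ?f U"
    by (rule continuous_attains_sup[OF compact_unitary])
      (use unitary_mat_1 in \<open>auto intro!: continuous_intros\<close>)
  then obtain U where U: "unitary U" and max: "\<And>V. unitary V \<Longrightarrow> ?f V \<le> ?f U" by auto
  define B where "B = cadjoint U ** A ** U"
  have B: "cadjoint B = B"
    using A by (simp add: B_def hermitian_def cadjoint_mult matrix_mul_assoc)
  have max': "Re (trace (D ** (cadjoint V ** B ** V))) \<le> Re (trace (D ** B))" if "unitary V" for V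
    using max[OF unitary_mult[OF U that]] by (simp add: B_def cadjoint_mult matrix_mul_assoc)
  have "Im (qform (D ** B) v) = 0" if v: "norm v = 1" for v
  proof -
    define w where "w = qform (D ** B) v"
    define c where "c = Re (trace (D ** (rank1 v ** B ** rank1 v)))"
    \<comment> \<open>\<open>?h t\<close> is the change of the objective when \<open>U\<close> is
      multiplied by \<open>phase (cis t) v\<close>; it is maximal at \<open>t = 0\<close>, where its
      derivative is \<open>- (2 * Im w)\<close>.\<close>
    let ?h = "\<lambda>t. 2 * ((cos t - 1) * Re w - sin t * Im w) + (2 - 2 * cos t) * c"
    have "?h t \<le> ?h 0" for t
    proof -
      define z where "z = cis t"
      have "trace (D ** (cadjoint (phase z v) ** B ** phase z v))
        = trace (D ** B) + (cnj z - 1) * trace (D ** (rank1 v ** B)) + (z - 1) * trace (D ** (B ** rank1 v))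
          + ((cnj z - 1) * (z - 1)) * trace (D ** (rank1 v ** B ** rank1 v))"
        unfolding cadjoint_phase
        by (simp add: phase_def matrix_distribs cmul_mult_left cmul_mult_right cmul_cmul
            cmul_add trace_add trace_cmul algebra_simps)
      moreover have "trace (D ** (rank1 v ** B)) = cnj w"
      proof -
        have "trace (D ** (rank1 v ** B)) = trace (cadjoint (D ** B) ** rank1 v)"
          by (simp add: cadjoint_mult B D_def) (metis matrix_mul_assoc trace_mul_sym)
        then show ?thesis by (simp add: trace_mult_rank1 qform_cadjoint w_def)
      qed
      moreover have "trace (D ** (B ** rank1 v)) = w"
        by (simp add: w_def matrix_mul_assoc trace_mult_rank1)
      moreover have "(cnj z - 1) * (z - 1) = of_real (2 - 2 * cos t)"
        by (simp add: z_def complex_eq_iff algebra_simps flip: power2_eq_square)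
      ultimately have "Re (trace (D ** (cadjoint (phase z v) ** B ** phase z v)))
          = Re (trace (D ** B)) + ?h t"
        by (simp add: c_def) (simp add: z_def algebra_simps)
      with max'[OF unitary_phase[OF v, of z]] show ?thesis by (simp add: z_def)
    qed
    moreover have "(?h has_real_derivative - (2 * Im w)) (at 0)"
      by (auto intro!: derivative_eq_intros)
    ultimately have "- (2 * Im w) = 0"
      by (intro DERIV_local_max[of ?h _ 0 1, OF _ zero_less_one] allI impI)
    then show ?thesis by (simp add: w_def)
  qed
  then have "cadjoint (D ** B) = D ** B"
    using hermitian_if_qform_real by (auto simp: hermitian_def)
  then have comm: "B ** D = D ** B" by (simp add: cadjoint_mult B D_def)
  have off: "B $ i $ j = 0" if "i \<noteq> j" for i j
  proof -
    have "B $ i $ j * of_nat (k j) = of_nat (k i) * B $ i $ j"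
      using arg_cong[OF comm, of "\<lambda>M. M $ i $ j"]
      by (simp add: D_def matrix_diag_real_nth diag_real_matrix_nth)
    moreover have "k i \<noteq> k j" using k that by (simp add: inj_eq)
    ultimately show ?thesis by (auto simp: mult.commute)
  qed
  have "Im (B $ i $ i) = 0" for i
    using arg_cong[OF B, of "\<lambda>M. M $ i $ i"] by (simp add: complex_eq_iff)
  with off have "B = diag_real (\<lambda>i. Re (B $ i $ i))"
    by (auto simp: vec_eq_iff diag_real_def complex_eq_iff)
  moreover have "A = U ** B ** cadjoint U"
    using U by (simp add: B_def matrix_mul_assoc[symmetric] unitary_cancel unitary_self)
  ultimately show ?thesis using that U by metis
qed

text \<open>Maximise \<open>Re (trace (U ** M))\<close> over the compact unitary group. At a
  maximiser no phase rotation increases the trace, so every value \<open>q\<close> of the form of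
  \<open>U ** M\<close> satisfies \<open>cmod q \<le> Re q\<close>. The maximality is kept in the
  conclusion as the variational formula for the trace norm.\<close>

lemma polar:
  fixes M :: "'n::finite cmatrix"
  obtains W where "unitary W" "psd (cadjoint W ** M)"
    "\<And>V. unitary V \<Longrightarrow> Re (trace (V ** M)) \<le> Re (trace (cadjoint W ** M))"
proof -
  have "\<exists>U\<in>Collect unitary. \<forall>V\<in>Collect unitary. Re (trace (V ** M)) \<le> Re (trace (U ** M))"
    by (rule continuous_attains_sup[OF compact_unitary])
      (use unitary_mat_1 in \<open>auto intro!: continuous_intros\<close>)
  then obtain U where U: "unitary U"
    and max: "\<And>V. unitary V \<Longrightarrow> Re (trace (V ** M)) \<le> Re (trace (U ** M))" by auto
  have "psd (U ** M)"
  proof (rule psd_if_qform)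
    fix v :: "(complex, 'n) vec" assume v: "norm v = 1"
    define q where "q = qform (U ** M) v"
    \<comment> \<open>This phase turns \<open>q\<close> into its modulus.\<close>
    define z where "z = (if q = 0 then 1 else cnj q / cmod q)"
    have z: "cmod z = 1" by (simp add: z_def norm_divide)
    have zq: "z * q = cmod q"
      using complex_norm_square[of q] by (auto simp: z_def field_simps power2_eq_square)
    have "Re (trace (phase z v ** (U ** M))) \<le> Re (trace (U ** M))"
      using max[OF unitary_mult[OF unitary_phase[OF v z] U]] by (simp add: matrix_mul_assoc)
    moreover have "trace (phase z v ** (U ** M)) = trace (U ** M) + (z - 1) * q"
      by (simp add: phase_def matrix_distribs cmul_mult_left trace_add trace_cmul q_def
          trace_mul_sym[of "rank1 v"] trace_mult_rank1)
    ultimately have "cmod q \<le> Re q" by (simp add: left_diff_distrib zq)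
    moreover have "(cmod q)\<^sup>2 = (Re q)\<^sup>2 + (Im q)\<^sup>2" by (simp add: cmod_power2)
    moreover have "\<bar>Re q\<bar> \<le> cmod q" by (rule abs_Re_le_cmod)
    moreover from calculation have "cmod q = Re q" by linarith
    ultimately have "0 \<le> Re q" "(Im q)\<^sup>2 = 0" by auto
    then show "Im (qform (U ** M) v) = 0 \<and> 0 \<le> Re (qform (U ** M) v)"
      unfolding q_def[symmetric] by simp
  qed
  then show ?thesis using that[of "cadjoint U"] U max by (simp add: unitary_cadjoint)
qed

section \<open>Positive semidefinite matrices\<close>

lemma psd_cadjoint: "psd A \<Longrightarrow> cadjoint A = A"
  by (simp add: psd_def hermitian_def)

lemma psd_add: "psd A \<Longrightarrow> psd B \<Longrightarrow> psd (A + B)"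
  by (simp add: psd_def hermitian_def cadjoint_add matrix_vector_mult_add_rdistrib inner_add_right)

lemma psd_scaleR:
  assumes "psd A" "0 \<le> c"
  shows "psd (c *\<^sub>R A)"
proof -
  have "(c *\<^sub>R A) *v v = c *\<^sub>R (A *v v)" for v
    by (simp add: vec_eq_iff matrix_vector_mult_def scaleR_sum_right)
  then show ?thesis using assms by (simp add: psd_def hermitian_def cadjoint_scaleR)
qed

lemma psd_congruence:
  assumes "psd M"
  shows "psd (A ** M ** cadjoint A)"
proof -
  have "v \<bullet> ((A ** M ** cadjoint A) *v v) = (cadjoint A *v v) \<bullet> (M *v (cadjoint A *v v))" for v
    by (simp add: inner_mult_vec matrix_vector_mul_assoc[symmetric])
  then show ?thesis
    using assms by (simp add: psd_def hermitian_def cadjoint_mult matrix_mul_assoc)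
qed

lemma psd_diag_real:
  assumes "\<And>i. 0 \<le> d i"
  shows "psd (diag_real d)"
proof -
  have "(diag_real d *v v) $ i = d i *\<^sub>R v $ i" for v i
    by (simp add: matrix_vector_mult_def diag_real_def scaleR_conv_of_real
        if_distrib[of "\<lambda>x. x * _"] cong: if_cong)
  then have "v \<bullet> (diag_real d *v v) = (\<Sum>i\<in>UNIV. d i * (v $ i \<bullet> v $ i))" for v
    by (simp add: inner_vec_def)
  then show ?thesis using assms by (simp add: psd_def hermitian_def sum_nonneg)
qed

lemma psd_mat_1: "psd (mat 1)"
  using psd_diag_real[of "\<lambda>i. 1"] by (simp add: diag_real_1)

lemma psd_mult_cadjoint: "psd (A ** cadjoint A)"
  using psd_congruence[OF psd_mat_1, of A] by simp

lemma psd_conjugate_diag_real: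
  "(\<And>i. 0 \<le> d i) \<Longrightarrow> psd (U ** diag_real d ** cadjoint U)"
  by (intro psd_congruence psd_diag_real)

lemma psd_diag_entry: "psd M \<Longrightarrow> 0 \<le> Re (M $ i $ i)"
  using Re_qform[of M "axis i 1"] by (simp add: psd_def qform_axis)

lemma psd_trace: "psd M \<Longrightarrow> 0 \<le> Re (trace M)"
  by (simp add: trace_def sum_nonneg psd_diag_entry)

lemma psd_spectral:
  assumes "psd A"
  obtains U d where "unitary U" "A = U ** diag_real d ** cadjoint U" "\<And>i. 0 \<le> d i"
proof -
  obtain U d where U: "unitary U" and A: "A = U ** diag_real d ** cadjoint U"
    using spectral[of A] assms by (auto simp: psd_def)
  have "cadjoint U ** A ** cadjoint (cadjoint U) = diag_real d"
    using U by (simp add: A matrix_mul_assoc[symmetric] unitary_cancel unitary_self)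
  then have "psd (diag_real d)" using psd_congruence[OF assms, of "cadjoint U"] by simp
  then have "0 \<le> d i" for i
    using psd_diag_entry[of "diag_real d" i] by (simp add: diag_real_def)
  then show ?thesis using that U A by blast
qed

lemma conjugate_diag_real_mult:
  assumes "unitary U"
  shows "(U ** diag_real d ** cadjoint U) ** (U ** diag_real e ** cadjoint U)
    = U ** diag_real (\<lambda>i. d i * e i) ** cadjoint U"
proof -
  have "(U ** diag_real d ** cadjoint U) ** (U ** diag_real e ** cadjoint U)
    = U ** (diag_real d ** diag_real e) ** cadjoint U"
    using assms by (simp add: matrix_mul_assoc[symmetric] unitary_cancel)
  then show ?thesis by (simp add: diag_real_mult)
qed

text \<open>An eigenbasis of \<open>S\<close> also diagonalises \<open>S ** S\<close>, and there
  \<open>sqrt\<close> undoes the squaring. Later proofs can thus exhibit a positive semidefinite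
  root instead of computing with \<open>herm_fun\<close>.\<close>

lemma mat_sqrt_mult_self:
  assumes "psd S"
  shows "mat_sqrt (S ** S) = S"
proof -
  obtain U d where U: "unitary U" and S: "S = U ** diag_real d ** cadjoint U" and d: "\<And>i. 0 \<le> d i"
    using psd_spectral[OF assms] by blast
  have "S ** S = U ** diag_real (\<lambda>i. d i * d i) ** cadjoint U"
    unfolding S by (rule conjugate_diag_real_mult[OF U])
  from herm_fun_eqI[OF U this, of sqrt] show ?thesis
    by (simp add: mat_sqrt_def S d)
qed

lemma psd_root:
  assumes "psd A"
  obtains S where "psd S" "S ** S = A"
proof -
  obtain U d where U: "unitary U" and A: "A = U ** diag_real d ** cadjoint U" and d: "\<And>i. 0 \<le> d i"
    using psd_spectral[OF assms] by blast
  show ?thesis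
    by (rule that[of "U ** diag_real (\<lambda>i. sqrt (d i)) ** cadjoint U"])
      (simp_all add: psd_conjugate_diag_real conjugate_diag_real_mult[OF U] A d)
qed

lemma mat_sqrt_psd:
  assumes "psd A"
  shows "psd (mat_sqrt A)" "mat_sqrt A ** mat_sqrt A = A"
  using psd_root[OF assms] mat_sqrt_mult_self by metis+

lemma mat_abs_eqI:
  "psd R \<Longrightarrow> R ** R = cadjoint X ** X \<Longrightarrow> mat_abs X = R"
  unfolding mat_abs_def by (metis mat_sqrt_mult_self)

text \<open>With a root \<open>S\<close> of \<open>A\<close>, the trace is that of the congruence
  \<open>S ** B ** cadjoint S\<close>.\<close>

lemma psd_trace_mult:
  assumes "psd A" "psd B"
  shows "0 \<le> Re (trace (A ** B))"
proof -
  obtain S where S: "psd S" "S ** S = A" using psd_root[OF assms(1)] .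
  have "trace (A ** B) = trace (S ** B ** cadjoint S)"
    using S by (metis matrix_mul_assoc psd_cadjoint trace_mul_sym)
  then show ?thesis using psd_trace[OF psd_congruence[OF assms(2)]] by simp
qed

lemma psd_trace_mono:
  assumes "psd X" "psd (B - A)"
  shows "Re (trace (X ** A)) \<le> Re (trace (X ** B))"
  using psd_trace_mult[OF assms] by (simp add: matrix_distribs trace_sub)

lemma closed_psd:
  fixes f :: "'a::topological_space \<Rightarrow> 'n::finite cmatrix"
  assumes "continuous_on UNIV f"
  shows "closed {x. psd (f x)}"
  unfolding psd_def hermitian_def
  by (intro closed_Collect_conj closed_Collect_all closed_Collect_eq closed_Collect_le
      continuous_intros assms)

section \<open>Fidelity and the smoothing ball\<close>

text \<open>The easy half of Uhlmann's theorem. Polar decomposition of \<open>cadjoint Z\<close>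
  gives \<open>mat_sqrt \<tau> = Z ** W\<close>, so the left side is the value at
  \<open>cadjoint W\<close> of the variational problem whose maximum is the fidelity.\<close>

lemma trace_le_fidelity:
  assumes "psd \<rho>" and Z: "\<tau> = Z ** cadjoint Z"
  shows "Re (trace (mat_sqrt \<rho> ** Z)) \<le> fidelity \<rho> \<tau>"
proof -
  obtain W where W: "unitary W" and P: "psd (cadjoint W ** cadjoint Z)"
    using polar by metis
  define P where "P = cadjoint W ** cadjoint Z"
  have PZ: "P = Z ** W"
    using psd_cadjoint[OF P] by (simp add: P_def cadjoint_mult)
  have "P ** P = \<tau>"
    by (subst PZ) (simp add: P_def Z matrix_mul_assoc[symmetric] unitary_cancel[OF W])
  then have \<tau>: "mat_sqrt \<tau> = P" using mat_sqrt_mult_self[OF P] by (simp add: P_def)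
  define X where "X = mat_sqrt \<rho> ** P"
  obtain V where V: "unitary V" and R: "psd (cadjoint V ** X)"
    and max: "\<And>V'. unitary V' \<Longrightarrow> Re (trace (V' ** X)) \<le> Re (trace (cadjoint V ** X))"
    using polar[of X] by metis
  \<comment> \<open>The positive semidefinite factor \<open>cadjoint V ** X\<close> is therefore
    \<open>mat_abs X\<close>.\<close>
  have "(cadjoint V ** X) ** (cadjoint V ** X) = cadjoint X ** X"
    using psd_cadjoint[OF R] V
    by (metis cadjoint_cadjoint cadjoint_mult matrix_mul_assoc unitary_cancel(2))
  then have "fidelity \<rho> \<tau> = Re (trace (cadjoint V ** X))"
    using mat_abs_eqI[OF R] by (simp add: fidelity_def \<tau> X_def)
  moreover have "trace (cadjoint W ** X) = trace (mat_sqrt \<rho> ** Z)"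
    by (metis PZ W X_def matrix_mul_assoc trace_mul_sym unitary_cancel(2) unitary_self(2) matrix_mul_rid)
  ultimately show ?thesis using max[OF unitary_cadjoint[OF W]] by simp
qed

text \<open>\<open>sqrt\<close> is strictly increasing on all reals, negative arguments included, so
  this also covers \<open>fidelity \<rho> \<tau> > 1\<close>.\<close>

lemma cdist_le_iff:
  assumes "0 \<le> \<epsilon>"
  shows "cdist \<rho> \<tau> \<le> \<epsilon> \<longleftrightarrow> 1 - (fidelity \<rho> \<tau>)\<^sup>2 \<le> \<epsilon>\<^sup>2"
  using real_sqrt_le_iff[of _ "\<epsilon>\<^sup>2"] assms by (simp add: cdist_def)

text \<open>The ball is the image, under \<open>S \<mapsto> S\<^sup>2\<close>, of the pairs \<open>(\<surd>\<tau>, \<bar>\<surd>\<rho> \<surd>\<tau>\<bar>)\<close>, which satisfy closed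
  polynomial conditions; so no continuity of the functional calculus is needed.\<close>
lemma compact_eps_ball:
  fixes \<rho> :: "'n::finite cmatrix"
  assumes \<rho>: "psd \<rho>" and \<epsilon>: "0 \<le> \<epsilon>"
  shows "compact (eps_ball \<epsilon> \<rho>)"
proof -
  define K :: "('n cmatrix \<times> 'n cmatrix) set" where
    "K = {p. psd (fst p) \<and> psd (snd p) \<and> Re (trace (fst p ** fst p)) \<le> 1 \<and>
       snd p ** snd p = fst p ** \<rho> ** fst p \<and> 1 - (Re (trace (snd p)))\<^sup>2 \<le> \<epsilon>\<^sup>2}"
  have norm_psd: "(norm S)\<^sup>2 = Re (trace (S ** S))" if "psd S" for S :: "'n cmatrix"
    using that by (simp add: norm_matrix_power2 psd_cadjoint)
  have "closed K"
    unfolding K_def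
    by (intro closed_Collect_conj closed_psd closed_Collect_eq closed_Collect_le continuous_intros)
  moreover have "bounded K"
  proof -
    \<comment> \<open>For pairs in \<open>K\<close> the squared norm of the second component is this
      trace at the first, and a continuous function is bounded on the unit ball.\<close>
    have "\<exists>S\<in>cball 0 1. \<forall>T\<in>cball 0 1. Re (trace (T ** \<rho> ** T)) \<le> Re (trace (S ** \<rho> ** S))"
      by (rule continuous_attains_sup) (auto intro!: continuous_intros)
    then obtain C where C: "\<And>T. norm T \<le> 1 \<Longrightarrow> Re (trace (T ** \<rho> ** T)) \<le> C"
      unfolding Ball_def mem_cball_0 by blast
    have "K \<subseteq> cball 0 1 \<times> cball 0 (sqrt C)"
    proof
      fix p assume p: "p \<in> K"
      then have "(norm (fst p))\<^sup>2 \<le> 1" by (simp add: K_def norm_psd)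
      then have 1: "norm (fst p) \<le> 1" by (simp add: power_le_one_iff)
      have "(norm (snd p))\<^sup>2 \<le> C" using p C[OF 1] by (simp add: K_def norm_psd)
      then have "norm (snd p) \<le> sqrt C" by (rule real_le_rsqrt)
      with 1 show "p \<in> cball 0 1 \<times> cball 0 (sqrt C)" by (cases p) simp
    qed
    then show ?thesis using bounded_subset[OF bounded_Times[OF bounded_cball bounded_cball]] by blast
  qed
  ultimately have "compact K" by (simp add: compact_eq_bounded_closed)
  then have "compact ((\<lambda>p. fst p ** fst p) ` K)"
    by (rule compact_continuous_image[rotated]) (intro continuous_intros)
  moreover have "(\<lambda>p. fst p ** fst p) ` K = eps_ball \<epsilon> \<rho>"
  proof (intro subset_antisym subsetI)
    fix \<tau> assume "\<tau> \<in> (\<lambda>p. fst p ** fst p) ` K"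
    then obtain S R where K: "(S, R) \<in> K" and \<tau>: "\<tau> = S ** S" by auto
    then have S: "psd S" "psd R" "R ** R = S ** \<rho> ** S" by (simp_all add: K_def)
    have "mat_abs (mat_sqrt \<rho> ** mat_sqrt \<tau>) = R"
      unfolding \<tau> mat_sqrt_mult_self[OF S(1)] using mat_sqrt_psd[OF \<rho>]
      by (intro mat_abs_eqI S) (simp add: S cadjoint_mult psd_cadjoint matrix_mul_assoc,
        metis matrix_mul_assoc)
    moreover have "psd \<tau>"
      using psd_mult_cadjoint[of S] S(1) by (simp add: \<tau> psd_cadjoint)
    ultimately show "\<tau> \<in> eps_ball \<epsilon> \<rho>"
      using K by (simp add: K_def eps_ball_def substates_def cdist_le_iff[OF \<epsilon>] fidelity_def \<tau>)
  next
    fix \<tau> assume "\<tau> \<in> eps_ball \<epsilon> \<rho>"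
    then have \<tau>: "psd \<tau>" "Re (trace \<tau>) \<le> 1" "1 - (fidelity \<rho> \<tau>)\<^sup>2 \<le> \<epsilon>\<^sup>2"
      by (simp_all add: eps_ball_def substates_def cdist_le_iff[OF \<epsilon>])
    define S where "S = mat_sqrt \<tau>"
    have S: "psd S" "S ** S = \<tau>" using mat_sqrt_psd[OF \<tau>(1)] by (simp_all add: S_def)
    define X where "X = mat_sqrt \<rho> ** S"
    have X: "cadjoint X ** X = S ** \<rho> ** S"
      using mat_sqrt_psd[OF \<rho>] S(1)
      by (simp add: X_def cadjoint_mult psd_cadjoint matrix_mul_assoc) (metis matrix_mul_assoc)
    have "psd (cadjoint X ** X)" using psd_mult_cadjoint[of "cadjoint X"] by simp
    then have "psd (mat_abs X)" "mat_abs X ** mat_abs X = S ** \<rho> ** S"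
      using mat_sqrt_psd X by (simp_all add: mat_abs_def)
    then have "(S, mat_abs X) \<in> K"
      using S \<tau> by (simp add: K_def fidelity_def X_def S_def)
    then show "\<tau> \<in> (\<lambda>p. fst p ** fst p) ` K" using S(2) by force
  qed
  ultimately show ?thesis by simp
qed

section \<open>Tensor products with an identity factor\<close>

lemma tensor_mult: "tensor A B ** tensor C D = tensor (A ** C) (B ** D)"
  by (simp add: vec_eq_iff tensor_def matrix_matrix_mult_def sum_product sum.cartesian_product
      case_prod_unfold mult_ac flip: UNIV_Times_UNIV)

lemma cadjoint_tensor: "cadjoint (tensor A B) = tensor (cadjoint A) (cadjoint B)"
  by (simp add: vec_eq_iff tensor_def)

lemma tensor_1_diag_real: "tensor (mat 1) (diag_real s) = diag_real (\<lambda>i. s (snd i))"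
  by (auto simp: vec_eq_iff tensor_def diag_real_def mat_def prod_eq_iff)

lemma tensor_1_conjugate:
  "tensor (mat 1) (V ** diag_real s ** cadjoint V)
    = tensor (mat 1) V ** diag_real (\<lambda>i. s (snd i)) ** cadjoint (tensor (mat 1) V)"
  by (simp add: tensor_mult cadjoint_tensor flip: tensor_1_diag_real)

lemma unitary_tensor_1:
  assumes "unitary V"
  shows "unitary (tensor (mat 1 :: 'a::finite cmatrix) V)"
proof -
  have "tensor (mat 1) (mat 1 :: 'b::finite cmatrix) = mat 1"
    using tensor_1_diag_real[of "\<lambda>_. 1"] by (simp add: diag_real_1)
  then show ?thesis using assms by (simp add: unitary_def cadjoint_tensor tensor_mult)
qed

lemma psd_tensor_1:
  assumes "psd \<sigma>"
  shows "psd (tensor (mat 1) \<sigma>)"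
proof -
  obtain V s where "\<sigma> = V ** diag_real s ** cadjoint V" "\<And>i. 0 \<le> s i"
    using psd_spectral[OF assms] by metis
  then show ?thesis by (simp add: tensor_1_conjugate psd_conjugate_diag_real)
qed

text \<open>\<open>GREATEST\<close> has the intended value only if the supremum \<open>h\<close> is
  attained. The sets \<open>F l\<close> are closed and shrink as \<open>l\<close> grows, so
  compactness of the ball yields one \<open>\<omega>\<close> that lies in \<open>F l\<close> for
  every real \<open>l\<close> below \<open>h\<close>.\<close>

lemma min_entropy_le_smooth_min_entropy:
  fixes \<rho> :: "('a::finite \<times> 'b::finite) cmatrix"
  assumes "psd \<rho>" "psd \<sigma>" "0 \<le> \<epsilon>" and \<tau>: "\<tau> \<in> eps_ball \<epsilon> \<rho>"
  shows "min_entropy \<tau> \<sigma> \<le> smooth_min_entropy \<epsilon> \<rho> \<sigma>"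
proof -
  define T :: "('a \<times> 'b) cmatrix" where "T = tensor (mat 1) \<sigma>"
  define F where "F l = {\<omega>. psd ((2 powr (- l)) *\<^sub>R T - \<omega>)}" for l
  have min_entropy: "min_entropy \<omega> \<sigma> = Sup {ereal l | l. \<omega> \<in> F l}" for \<omega>
    by (simp add: min_entropy_def loewner_le_def F_def T_def)
  have F_mono: "F l' \<subseteq> F l" if "l \<le> l'" for l l'
  proof
    fix \<omega> assume "\<omega> \<in> F l'"
    then have "psd ((2 powr (- l')) *\<^sub>R T - \<omega>)" by (simp add: F_def)
    moreover have "psd ((2 powr (- l) - 2 powr (- l')) *\<^sub>R T)"
      using that psd_tensor_1[OF \<open>psd \<sigma>\<close>] by (intro psd_scaleR) (simp_all add: T_def)
    ultimately have "psd ((2 powr (- l') *\<^sub>R T - \<omega>) + (2 powr (- l) - 2 powr (- l')) *\<^sub>R T)"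
      by (rule psd_add)
    then show "\<omega> \<in> F l" by (simp add: F_def algebra_simps)
  qed
  let ?B = "eps_ball \<epsilon> \<rho>"
  define h where "h = (SUP \<omega>\<in>?B. min_entropy \<omega> \<sigma>)"
  let ?I = "{l. ereal l < h}"
  have "?B \<inter> \<Inter> (F ` ?I) \<noteq> {}"
  proof (rule compact_imp_fip_image)
    show "compact ?B" using assms by (simp add: compact_eps_ball)
    show "closed (F l)" for l
      unfolding F_def by (intro closed_psd continuous_intros)
    fix J assume J: "finite J" "J \<subseteq> ?I"
    show "?B \<inter> \<Inter> (F ` J) \<noteq> {}"
    proof (cases "J = {}")
      case False
      \<comment> \<open>By monotonicity, finitely many constraints reduce to the one with the
        largest index.\<close>
      then have "ereal (Max J) < h" using J Max_in by auto
      then obtain \<omega> where \<omega>: "\<omega> \<in> ?B" "ereal (Max J) < min_entropy \<omega> \<sigma>"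
        by (auto simp: h_def less_SUP_iff)
      then obtain l where l: "Max J < l" "\<omega> \<in> F l"
        by (auto simp: min_entropy less_Sup_iff)
      have "\<omega> \<in> F j" if "j \<in> J" for j
        using F_mono[of j l] Max_ge[OF J(1) that] l by auto
      then show ?thesis using \<omega>(1) by blast
    qed (use \<tau> in auto)
  qed
  then obtain \<omega> where \<omega>: "\<omega> \<in> ?B" "\<And>l. ereal l < h \<Longrightarrow> \<omega> \<in> F l" by blast
  have "h \<le> min_entropy \<omega> \<sigma>"
  \<comment> \<open>\<open>h\<close> may be infinite; comparing with every \<open>x < h\<close>
    treats all cases alike.\<close>
  proof (rule dense_le)
    fix x assume "x < h"
    then show "x \<le> min_entropy \<omega> \<sigma>"
      by (cases x) (use \<omega>(2) in \<open>auto simp: min_entropy intro: Sup_upper\<close>)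
  qed
  then have "min_entropy \<omega> \<sigma> = h"
    using \<omega>(1) by (auto simp: h_def intro!: antisym SUP_upper)
  then have "smooth_min_entropy \<epsilon> \<rho> \<sigma> = h"
    unfolding smooth_min_entropy_def using \<omega>(1)
    by (intro Greatest_equality image_eqI[of _ _ \<omega>]) (auto simp: h_def intro: SUP_upper)
  then show ?thesis using \<tau> by (auto simp: h_def intro: SUP_upper)
qed

section \<open>The smoothed state\<close>

text \<open>In the eigenbasis of \<open>T - S\<close>, with eigenvalues \<open>d\<close>, the diagonal entries of \<open>T\<^sup>2 - S\<^sup>2\<close> are
  \<open>2 d T - d\<^sup>2\<close>, which is negative where \<open>d < 0\<close>.\<close>
lemma psd_root_mono:
  assumes T: "psd T" and S: "psd S" and TS: "psd (T ** T - S ** S)"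
  shows "psd (T - S)"
proof -
  obtain U d where U: "unitary U" and D: "T - S = U ** diag_real d ** cadjoint U"
    using spectral[of "T - S"] S T by (auto simp: hermitian_def cadjoint_diff psd_cadjoint)
  define T' where "T' = cadjoint U ** T ** U"
  have T': "psd T'" using psd_congruence[OF T, of "cadjoint U"] by (simp add: T'_def)
  have "T ** T - S ** S = T ** (T - S) + (T - S) ** T - (T - S) ** (T - S)"
    by (simp add: matrix_distribs)
  then have "cadjoint U ** (T ** T - S ** S) ** cadjoint (cadjoint U)
      = T' ** diag_real d + diag_real d ** T' - diag_real d ** diag_real d"
    unfolding D T'_def using U
    by (simp add: matrix_distribs matrix_mul_assoc[symmetric] unitary_cancel unitary_self)
  then have "psd (T' ** diag_real d + diag_real d ** T' - diag_real d ** diag_real d)"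
    using psd_congruence[OF TS, of "cadjoint U"] by simp
  from psd_diag_entry[OF this] have e: "0 \<le> 2 * d i * Re (T' $ i $ i) - d i * d i" for i
    by (simp add: matrix_diag_real_nth diag_real_matrix_nth diag_real_mult)
      (simp add: diag_real_def algebra_simps)
  have "0 \<le> d i" for i
  proof (rule ccontr)
    assume "\<not> 0 \<le> d i"
    then have "2 * d i * Re (T' $ i $ i) \<le> 0" "0 < d i * d i"
      using psd_diag_entry[OF T', of i] by (auto simp: mult_nonpos_nonneg mult_neg_neg)
    then show False using e[of i] by linarith
  qed
  then show ?thesis by (simp add: D psd_conjugate_diag_real)
qed

text \<open>The trace of \<open>A ** cadjoint A\<close> is a squared Frobenius norm, here also at
  most 0.\<close>

lemma psd_neg_mult_cadjoint_imp_zero: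
  assumes "psd (- (A ** cadjoint A))"
  shows "A = 0"
proof -
  have "trace (- (A ** cadjoint A)) = - trace (A ** cadjoint A)"
    by (simp add: trace_def sum_negf)
  then have "Re (trace (A ** cadjoint A)) \<le> 0"
    using psd_trace[OF assms] by simp
  then have "(norm (cadjoint A))\<^sup>2 \<le> 0"
    using norm_matrix_power2[of "cadjoint A"] by simp
  then have "cadjoint A = 0" by simp
  then have "cadjoint (cadjoint A) = 0" by (simp add: vec_eq_iff)
  then show ?thesis by simp
qed

text \<open>The contraction is \<open>T\<^sup>+ Q\<close> for the pseudo-inverse \<open>T\<^sup>+\<close>, which \<open>1 / 0 = 0\<close> provides.\<close>
lemma douglas_factorization:
  assumes C: "psd C" and CQ: "psd (C - Q ** cadjoint Q)"
  obtains T K where "psd T" "T ** T = C" "T ** K = Q" "psd (mat 1 - K ** cadjoint K)"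
proof -
  obtain V c where V: "unitary V" and Cd: "C = V ** diag_real c ** cadjoint V" and c: "\<And>i. 0 \<le> c i"
    using psd_spectral[OF C] by blast
  let ?conj = "\<lambda>d. V ** diag_real d ** cadjoint V"
  define T where "T = ?conj (\<lambda>i. sqrt (c i))"
  define R where "R = ?conj (\<lambda>i. 1 / sqrt (c i))"
  \<comment> \<open>The projection onto the kernel of \<open>C\<close>.\<close>
  define N where "N = ?conj (\<lambda>i. if c i = 0 then 1 else 0)"
  have mult: "?conj d ** ?conj e = ?conj (\<lambda>i. d i * e i)" for d e
    by (rule conjugate_diag_real_mult[OF V])
  have "?conj (\<lambda>i. 1) = mat 1" using V by (simp add: diag_real_1 unitary_self)
  then have minus_N: "mat 1 - N = ?conj (\<lambda>i. 1 - (if c i = 0 then 1 else 0))"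
    unfolding N_def by (simp add: matrix_distribs flip: diag_real_diff)
  have adj: "cadjoint N = N" "cadjoint R = R"
    by (simp_all add: N_def R_def cadjoint_mult matrix_mul_assoc)
  have TT: "T ** T = C" unfolding T_def mult Cd using c by simp
  have TR: "T ** R = mat 1 - N"
    unfolding T_def R_def mult minus_N using c
    by (intro arg_cong[where f = "\<lambda>d. ?conj d"] ext) auto
  have RCR: "R ** C ** R = mat 1 - N"
    unfolding R_def Cd mult minus_N using c
    by (intro arg_cong[where f = "\<lambda>d. ?conj d"] ext) (auto simp: field_simps)
  have NC: "N ** C = 0"
  proof -
    have "N ** C = ?conj (\<lambda>i. 0)"
      unfolding N_def Cd mult by (intro arg_cong[where f = "\<lambda>d. ?conj d"] ext) auto
    also have "diag_real (\<lambda>i. 0) = (0 :: 'a cmatrix)"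
      by (simp add: vec_eq_iff diag_real_def)
    finally show ?thesis by simp
  qed
  \<comment> \<open>Compressing the hypothesis to the kernel of \<open>C\<close> leaves a negative
    square, so \<open>Q\<close> has no component there.\<close>
  have "N ** (C - Q ** cadjoint Q) ** cadjoint N = - ((N ** Q) ** cadjoint (N ** Q))"
    using matrix_diff_rdistrib[of 0 "N ** Q ** cadjoint Q" "cadjoint N"]
    by (simp add: matrix_distribs NC cadjoint_mult matrix_mul_assoc)
  then have "N ** Q = 0"
    using psd_congruence[OF CQ, of N] psd_neg_mult_cadjoint_imp_zero by metis
  then have "T ** (R ** Q) = Q"
    by (simp add: matrix_mul_assoc TR matrix_distribs)
  moreover have "psd (mat 1 - (R ** Q) ** cadjoint (R ** Q))"
  proof -
    have "mat 1 - (R ** Q) ** cadjoint (R ** Q) = N + R ** (C - Q ** cadjoint Q) ** cadjoint R"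
      by (simp add: matrix_distribs RCR cadjoint_mult matrix_mul_assoc adj)
    moreover have "psd N" unfolding N_def by (rule psd_conjugate_diag_real) simp
    ultimately show ?thesis using psd_congruence[OF CQ] psd_add by metis
  qed
  moreover have "psd T" unfolding T_def by (rule psd_conjugate_diag_real) (simp add: c)
  ultimately show ?thesis using that TT by blast
qed

text \<open>Replacing the root \<open>T\<close> of \<open>C\<close> by the root \<open>S\<close> of
  \<open>B\<close> in \<open>mat_sqrt \<rho> = T ** K\<close> carries \<rho> to a state below
  \<open>B\<close>; the loss of fidelity is controlled by the trace of \<open>C - B\<close>.\<close>

lemma smoothed_state:
  fixes \<rho> :: "'n::finite cmatrix"
  assumes \<rho>: "psd \<rho>" "trace \<rho> = 1" and B: "psd B" and BC: "psd (C - B)" and C\<rho>: "psd (C - \<rho>)"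
  obtains \<tau> where "psd \<tau>" "psd (B - \<tau>)" "Re (trace \<tau>) \<le> 1"
    "1 - Re (trace (C - B)) \<le> fidelity \<rho> \<tau>"
proof -
  define Q where "Q = mat_sqrt \<rho>"
  have Q: "cadjoint Q = Q" "Q ** Q = \<rho>"
    using mat_sqrt_psd[OF \<rho>(1)] by (simp_all add: Q_def psd_cadjoint)
  have "psd C" using psd_add[OF B BC] by simp
  then obtain T K where T: "psd T" "T ** T = C" and K: "T ** K = Q" "psd (mat 1 - K ** cadjoint K)"
    using douglas_factorization[of C Q] C\<rho> Q by metis
  obtain S where S: "psd S" "S ** S = B" using psd_root[OF B] .
  note adj = psd_cadjoint[OF S(1)] psd_cadjoint[OF T(1)]
  define E where "E = K ** cadjoint K"
  have E: "psd E" unfolding E_def by (rule psd_mult_cadjoint)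
  define \<tau> where "\<tau> = (S ** K) ** cadjoint (S ** K)"
  have \<tau>: "\<tau> = S ** E ** S" by (simp add: \<tau>_def E_def cadjoint_mult adj matrix_mul_assoc)
  have "T ** E ** T = (T ** K) ** cadjoint (T ** K)"
    by (simp add: E_def cadjoint_mult adj matrix_mul_assoc)
  then have "trace (T ** E ** T) = 1" using Q \<rho> by (simp add: K)
  then have EC: "trace (E ** C) = 1"
    by (metis T(2) matrix_mul_assoc trace_mul_sym)
  have 1: "psd \<tau>" unfolding \<tau>_def by (rule psd_mult_cadjoint)
  have 2: "psd (B - \<tau>)"
    using psd_congruence[OF K(2), of S]
    by (simp add: matrix_distribs adj S(2) \<tau> E_def[symmetric])
  have "trace \<tau> = trace (E ** B)"
    unfolding \<tau> by (metis S(2) matrix_mul_assoc trace_mul_sym)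
  \<comment> \<open>The trace of \<tau> is that of \<open>E ** B\<close>, and \<open>B\<close> lies
    below \<open>C\<close>, where \<open>trace (E ** C) = trace \<rho> = 1\<close>.\<close>
  then have 3: "Re (trace \<tau>) \<le> 1"
    using psd_trace_mono[OF E BC] EC by simp
  have Qc: "Q = cadjoint K ** T"
    using Q(1) K(1) adj by (metis cadjoint_mult)
  have tr1: "trace (Q ** (S ** K)) = trace (E ** (T ** S))"
    unfolding Qc E_def by (metis matrix_mul_assoc trace_mul_sym)
  have "trace (E ** (S ** T)) = trace (cadjoint (E ** (T ** S)))"
    by (metis E adj cadjoint_mult psd_cadjoint trace_mul_sym)
  then have tr2: "Re (trace (E ** (S ** T))) = Re (trace (E ** (T ** S)))"
    by (simp add: trace_cadjoint)
  \<comment> \<open>Since \<open>E\<close> lies below the identity,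
    \<open>Re (trace (M ** E)) \<le> Re (trace M)\<close>; expanding \<open>M\<close> turns this
    into a lower bound on the overlap \<open>Re (trace (E ** (T ** S)))\<close>.\<close>
  define M where "M = (C - B) + (T - S) ** cadjoint (T - S)"
  have M: "psd M" unfolding M_def by (intro psd_add BC psd_mult_cadjoint)
  have M_eq: "M = (C - T ** S) + (C - S ** T)"
    by (simp add: M_def matrix_distribs cadjoint_diff adj S T)
  have "Re (trace (M ** E)) \<le> Re (trace (M ** mat 1))"
    by (rule psd_trace_mono[OF M]) (use K(2) in \<open>simp add: E_def\<close>)
  moreover have "Re (trace (M ** E)) = 2 - 2 * Re (trace (E ** (T ** S)))"
  proof -
    have "trace (E ** M) = trace (E ** C) - trace (E ** (T ** S)) + (trace (E ** C) - trace (E ** (S ** T)))"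
      unfolding M_eq matrix_add_ldistrib matrix_diff_ldistrib trace_sub trace_add by (rule refl)
    then show ?thesis by (simp add: trace_mul_sym[of M E] EC tr2)
  qed
  moreover have "Re (trace M) = 2 * Re (trace C) - 2 * Re (trace (S ** T))"
    unfolding M_eq trace_sub trace_add trace_mul_sym[of T S] by simp
  \<comment> \<open>Monotonicity of the square root, \<open>S\<close> below \<open>T\<close>,
    replaces the mixed trace by that of \<open>B\<close>.\<close>
  moreover have "Re (trace B) \<le> Re (trace (S ** T))"
    using psd_trace_mono[OF S(1) psd_root_mono[OF T(1) S(1)]] BC by (simp add: S T)
  ultimately have "1 - Re (trace (C - B)) \<le> Re (trace (Q ** (S ** K)))"
    by (simp add: tr1 trace_sub)
  also have "\<dots> \<le> fidelity \<rho> \<tau>"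
    unfolding Q_def by (rule trace_le_fidelity[OF \<rho>(1) \<tau>_def])
  finally show ?thesis using that 1 2 3 by blast
qed

text \<open>The bound is assumed for all projections because the one used, onto the positive part
  \<Delta> of \<open>\<rho> - B\<close>, depends on \<open>B\<close>. It gives \<Delta> trace at
  most \<open>\<epsilon>\<^sup>2 / 2\<close>, and \<open>smoothed_state\<close> is applied with
  \<open>C = B + \<Delta>\<close>.\<close>

lemma eps_ball_below:
  fixes \<rho> :: "'n::finite cmatrix"
  assumes \<rho>: "\<rho> \<in> states" and B: "psd B" and \<epsilon>: "0 \<le> \<epsilon>"
    and proj: "\<And>P. cadjoint P = P \<Longrightarrow> P ** P = P \<Longrightarrow> Re (trace (P ** (\<rho> - B))) \<le> \<epsilon>\<^sup>2 / 2"
  obtains \<tau> where "\<tau> \<in> eps_ball \<epsilon> \<rho>" "psd (B - \<tau>)"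
proof -
  have \<rho>': "psd \<rho>" "trace \<rho> = 1" using \<rho> by (simp_all add: states_def)
  obtain U d where U: "unitary U" and D: "\<rho> - B = U ** diag_real d ** cadjoint U"
    using spectral[of "\<rho> - B"] \<rho>' B by (auto simp: hermitian_def cadjoint_diff psd_cadjoint)
  let ?conj = "\<lambda>d. U ** diag_real d ** cadjoint U"
  define P where "P = ?conj (\<lambda>i. if 0 < d i then 1 else 0)"
  define \<Delta> where "\<Delta> = ?conj (\<lambda>i. max (d i) 0)"
  have \<Delta>: "psd \<Delta>" unfolding \<Delta>_def by (rule psd_conjugate_diag_real) simp
  have "P ** (\<rho> - B) = \<Delta>"
    unfolding P_def D \<Delta>_def conjugate_diag_real_mult[OF U]
    by (intro arg_cong[where f = "\<lambda>d. ?conj d"] ext) auto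
  moreover have "P ** P = P"
    unfolding P_def conjugate_diag_real_mult[OF U]
    by (intro arg_cong[where f = "\<lambda>d. ?conj d"] ext) auto
  moreover have "cadjoint P = P"
    by (simp add: P_def cadjoint_mult matrix_mul_assoc)
  ultimately have tr: "Re (trace \<Delta>) \<le> \<epsilon>\<^sup>2 / 2" using proj by metis
  have "psd (B + \<Delta> - \<rho>)"
  proof -
    have "B + \<Delta> - \<rho> = \<Delta> - (\<rho> - B)" by simp
    also have "\<dots> = ?conj (\<lambda>i. max (d i) 0 - d i)"
      unfolding D \<Delta>_def by (simp add: matrix_distribs flip: diag_real_diff)
    finally show ?thesis by (simp add: psd_conjugate_diag_real)
  qed
  then obtain \<tau> where \<tau>: "psd \<tau>" "psd (B - \<tau>)" "Re (trace \<tau>) \<le> 1" "1 - Re (trace \<Delta>) \<le> fidelity \<rho> \<tau>"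
    using smoothed_state[OF \<rho>' B, of "B + \<Delta>"] \<Delta> by auto
  \<comment> \<open>Squaring \<open>1 - Re (trace \<Delta>) \<le> fidelity \<rho> \<tau>\<close>
    requires a nonnegative left side; otherwise the right side of the claim exceeds 2.\<close>
  have "1 - (fidelity \<rho> \<tau>)\<^sup>2 \<le> 2 * Re (trace \<Delta>)"
  proof (cases "Re (trace \<Delta>) \<le> 1")
    case True
    then have "(1 - Re (trace \<Delta>))\<^sup>2 \<le> (fidelity \<rho> \<tau>)\<^sup>2" using \<tau>(4) by (intro power_mono) auto
    moreover have "(1 - Re (trace \<Delta>))\<^sup>2 = 1 - 2 * Re (trace \<Delta>) + (Re (trace \<Delta>))\<^sup>2"
      by (simp add: power2_diff)
    ultimately show ?thesis using zero_le_power2[of "Re (trace \<Delta>)"] by linarith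
  next
    case False
    then show ?thesis using zero_le_power2[of "fidelity \<rho> \<tau>"] by linarith
  qed
  then have "\<tau> \<in> eps_ball \<epsilon> \<rho>"
    using \<tau> tr by (simp add: eps_ball_def substates_def cdist_le_iff[OF \<epsilon>])
  then show ?thesis using that \<tau>(2) by blast
qed

section \<open>The trace inequality\<close>

lemma trace_diag_mult_cadjoint:
  "trace (diag_real r ** (X ** cadjoint Y)) = (\<Sum>j\<in>UNIV. \<Sum>k\<in>UNIV. of_real (r j) * (X $ j $ k * cnj (Y $ j $ k)))"
  unfolding trace_diag_mult by (simp add: matrix_matrix_mult_def sum_distrib_left)

lemma Re_scaled_mult_cnj:
  "Re (of_real a * (x * cnj x)) = a * (cmod x)\<^sup>2" "Re (of_real a * (cnj x * x)) = a * (cmod x)\<^sup>2"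
  unfolding cmod_power2 by (simp_all add: power2_eq_square)

lemma trace_conjugate_diag_real_mult:
  assumes "w = cadjoint U ** W"
  shows "Re (trace ((U ** diag_real a ** cadjoint U) ** (W ** diag_real c ** cadjoint W)))
    = (\<Sum>j\<in>UNIV. \<Sum>k\<in>UNIV. (cmod (w $ j $ k))\<^sup>2 * a j * c k)"
proof -
  have "trace ((U ** diag_real a ** cadjoint U) ** (W ** diag_real c ** cadjoint W))
    = trace (diag_real a ** ((w ** diag_real c) ** cadjoint w))"
    unfolding assms cadjoint_mult cadjoint_cadjoint by (metis matrix_mul_assoc trace_mul_sym)
  also have "Re \<dots> = (\<Sum>j\<in>UNIV. \<Sum>k\<in>UNIV. (cmod (w $ j $ k))\<^sup>2 * a j * c k)"
    unfolding trace_diag_mult_cadjoint Re_sum cmod_power2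
    by (intro sum.cong refl) (simp add: matrix_diag_real_nth power2_eq_square algebra_simps)
  finally show ?thesis .
qed

text \<open>The left side is at most both \<open>r\<close> and \<open>r\<^sup>2 / b\<close>.
  Multiply the smaller one by a power that is at least 1: \<open>(r / b) powr (\<alpha> - 1)\<close>
  or \<open>(b / r) powr (2 - \<alpha>)\<close>, the latter using
  \<open>\<alpha> \<le> 2\<close>.\<close>

lemma square_div_add_le_powr:
  fixes r b :: real
  assumes r: "0 < r" and b: "0 < b" and \<alpha>: "1 < \<alpha>" "\<alpha> \<le> 2"
  shows "r\<^sup>2 / (r + b) \<le> r powr \<alpha> * b powr (1 - \<alpha>)"
proof (cases "b \<le> r")
  case True
  have "r\<^sup>2 / (r + b) \<le> r * 1"
    using r b by (simp add: field_simps power2_eq_square)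
  also have "\<dots> \<le> r * (r / b) powr (\<alpha> - 1)"
    using r b True \<alpha> by (intro mult_left_mono ge_one_powr_ge_zero) auto
  also have "\<dots> = r powr \<alpha> * b powr (1 - \<alpha>)"
    using r b by (simp add: powr_divide powr_diff)
  finally show ?thesis .
next
  case False
  have "r\<^sup>2 / (r + b) \<le> r\<^sup>2 / b * 1"
    using r b by (simp add: field_simps)
  also have "\<dots> \<le> r\<^sup>2 / b * (b / r) powr (2 - \<alpha>)"
    using r b False \<alpha> by (intro mult_left_mono ge_one_powr_ge_zero) auto
  also have "\<dots> = r powr \<alpha> * b powr (1 - \<alpha>)"
    using r b by (simp add: powr_divide powr_diff powr_numeral field_simps power2_eq_square)
  finally show ?thesis .
qed

text \<open>Completing the square in \<open>cmod z\<close> bounds the left side by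
  \<open>(cmod w)\<^sup>2 * (r\<^sup>2 / (r + b))\<close>. The support condition excludes
  \<open>b = 0\<close> with \<open>w\<close> and \<open>r\<close> nonzero, where the convention
  \<open>0 powr (1 - \<alpha>) = 0\<close> would break the bound.\<close>

lemma quadratic_le_powr:
  fixes r b :: real and w z :: complex
  assumes r: "0 \<le> r" and b: "0 \<le> b" and supp: "w \<noteq> 0 \<Longrightarrow> 0 < r \<Longrightarrow> 0 < b"
    and \<alpha>: "1 < \<alpha>" "\<alpha> \<le> 2"
  shows "2 * r * Re (w * cnj z) - (r + b) * (cmod z)\<^sup>2 \<le> (cmod w)\<^sup>2 * r powr \<alpha> * b powr (1 - \<alpha>)"
proof (cases "w = 0 \<or> r = 0")
  case True
  then show ?thesis using r b by auto
next
  case False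
  then have r: "0 < r" and b: "0 < b" using r supp by auto
  have "2 * r * Re (w * cnj z) \<le> 2 * r * (cmod w * cmod z)"
    using r complex_Re_le_cmod[of "w * cnj z"] by (intro mult_left_mono) (auto simp: norm_mult)
  moreover have "2 * r * (cmod w * cmod z) - (r + b) * (cmod z)\<^sup>2
      = (cmod w)\<^sup>2 * (r\<^sup>2 / (r + b)) - (r * cmod w - (r + b) * cmod z)\<^sup>2 / (r + b)"
  proof -
    have "2 * r * (x * y) - s * y\<^sup>2 = x\<^sup>2 * (r\<^sup>2 / s) - (r * x - s * y)\<^sup>2 / s" if "0 < s" for x y s :: real
      using that by (simp add: field_simps power2_eq_square)
    then show ?thesis using r b by simp
  qed
  moreover have "0 \<le> (r * cmod w - (r + b) * cmod z)\<^sup>2 / (r + b)" using r b by simp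
  moreover have "(cmod w)\<^sup>2 * (r\<^sup>2 / (r + b)) \<le> (cmod w)\<^sup>2 * (r powr \<alpha> * b powr (1 - \<alpha>))"
    using square_div_add_le_powr[OF r b \<alpha>] by (intro mult_left_mono) auto
  ultimately show ?thesis by (simp add: mult.assoc)
qed

text \<open>With \<open>z = U\<^sup>\<dagger> P W\<close>, the sum of \<open>2 r Re (w z\<^sup>*) - (r + b) \<bar>z\<bar>\<^sup>2\<close> over all entries is
  \<open>2 tr (P \<rho>) - tr (P \<rho>) - tr (P B)\<close>, because \<open>P\<close> is a projection; each entry is bounded by
  completing the square.\<close>
lemma trace_projection_le_powr:
  assumes U: "unitary U" and W: "unitary W" and w: "w = cadjoint U ** W"
    and r: "\<And>j. 0 \<le> r j" and b: "\<And>k. 0 \<le> b k"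
    and supp: "\<And>j k. w $ j $ k \<noteq> 0 \<Longrightarrow> 0 < r j \<Longrightarrow> 0 < b k"
    and \<alpha>: "1 < \<alpha>" "\<alpha> \<le> 2" and P: "cadjoint P = P" "P ** P = P"
  shows "Re (trace (P ** (U ** diag_real r ** cadjoint U - W ** diag_real b ** cadjoint W)))
    \<le> (\<Sum>j\<in>UNIV. \<Sum>k\<in>UNIV. (cmod (w $ j $ k))\<^sup>2 * r j powr \<alpha> * b k powr (1 - \<alpha>))"
proof -
  define \<rho> where "\<rho> = U ** diag_real r ** cadjoint U"
  define B where "B = W ** diag_real b ** cadjoint W"
  define z where "z = cadjoint U ** P ** W"
  have cz: "cadjoint z = cadjoint W ** P ** U"
    by (simp add: z_def cadjoint_mult P matrix_mul_assoc)
  have PP: "P ** (P ** X) = P ** X" for X by (simp add: matrix_mul_assoc P)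
  have "w ** cadjoint z = cadjoint U ** P ** U" "z ** cadjoint z = cadjoint U ** P ** U"
    unfolding w cz using W by (simp_all add: z_def matrix_mul_assoc[symmetric] unitary_cancel PP)
  moreover have "trace (diag_real r ** (cadjoint U ** P ** U)) = trace (P ** \<rho>)"
    unfolding \<rho>_def by (metis matrix_mul_assoc trace_mul_sym)
  ultimately have 1: "trace (P ** \<rho>) = trace (diag_real r ** (w ** cadjoint z))"
    "trace (P ** \<rho>) = trace (diag_real r ** (z ** cadjoint z))" by simp_all
  have "cadjoint z ** z = cadjoint W ** P ** W"
    unfolding cz using U by (simp add: z_def matrix_mul_assoc[symmetric] unitary_cancel PP)
  then have "trace (P ** B) = trace (diag_real b ** (cadjoint z ** cadjoint (cadjoint z)))"
    unfolding B_def cadjoint_cadjoint by (metis matrix_mul_assoc trace_mul_sym)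
  then have "Re (trace (P ** B)) = (\<Sum>k\<in>UNIV. \<Sum>j\<in>UNIV. b k * (cmod (z $ j $ k))\<^sup>2)"
    unfolding trace_diag_mult_cadjoint by (simp add: Re_scaled_mult_cnj del: times_complex.sel)
  also have "\<dots> = (\<Sum>j\<in>UNIV. \<Sum>k\<in>UNIV. b k * (cmod (z $ j $ k))\<^sup>2)" by (rule sum.swap)
  finally have B: "Re (trace (P ** B)) = (\<Sum>j\<in>UNIV. \<Sum>k\<in>UNIV. b k * (cmod (z $ j $ k))\<^sup>2)" .
  have \<rho>1: "Re (trace (P ** \<rho>)) = (\<Sum>j\<in>UNIV. \<Sum>k\<in>UNIV. r j * Re (w $ j $ k * cnj (z $ j $ k)))"
    unfolding 1(1) trace_diag_mult_cadjoint by (simp add: distrib_left)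
  have \<rho>2: "Re (trace (P ** \<rho>)) = (\<Sum>j\<in>UNIV. \<Sum>k\<in>UNIV. r j * (cmod (z $ j $ k))\<^sup>2)"
    unfolding 1(2) trace_diag_mult_cadjoint by (simp add: Re_scaled_mult_cnj del: times_complex.sel)
  have "Re (trace (P ** (\<rho> - B)))
      = 2 * Re (trace (P ** \<rho>)) - (Re (trace (P ** \<rho>)) + Re (trace (P ** B)))"
    by (simp add: matrix_distribs trace_sub)
  also have "\<dots> = 2 * (\<Sum>j\<in>UNIV. \<Sum>k\<in>UNIV. r j * Re (w $ j $ k * cnj (z $ j $ k)))
      - ((\<Sum>j\<in>UNIV. \<Sum>k\<in>UNIV. r j * (cmod (z $ j $ k))\<^sup>2) + (\<Sum>j\<in>UNIV. \<Sum>k\<in>UNIV. b k * (cmod (z $ j $ k))\<^sup>2))"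
    by (subst \<rho>2[symmetric], subst B[symmetric], subst \<rho>1[symmetric]) simp
  also have "\<dots> = (\<Sum>j\<in>UNIV. \<Sum>k\<in>UNIV.
      2 * r j * Re (w $ j $ k * cnj (z $ j $ k)) - (r j + b k) * (cmod (z $ j $ k))\<^sup>2)"
    by (simp add: sum_subtractf sum.distrib sum_distrib_left distrib_right mult.assoc)
  also have "\<dots> \<le> (\<Sum>j\<in>UNIV. \<Sum>k\<in>UNIV. (cmod (w $ j $ k))\<^sup>2 * r j powr \<alpha> * b k powr (1 - \<alpha>))"
    by (intro sum_mono quadratic_le_powr r b \<alpha> supp)
  finally show ?thesis by (simp add: \<rho>_def B_def)
qed

section \<open>The \<open>\<alpha>\<close>-entropy in eigenbases\<close>

text \<open>\<open>r\<close> and \<open>s\<close> are the spectra of \<open>\<rho>\<close> and \<open>\<sigma>\<close>, and \<open>w\<close> the matrix of overlaps between the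
  eigenvectors of \<open>\<rho>\<close> and those of \<open>1 \<otimes> \<sigma>\<close>.\<close>
definition overlap_sum ::
    "real \<Rightarrow> ('a::finite \<times> 'b::finite) cmatrix \<Rightarrow> ('a \<times> 'b \<Rightarrow> real) \<Rightarrow> ('b \<Rightarrow> real) \<Rightarrow> real" where
  "overlap_sum \<alpha> w r s = (\<Sum>j\<in>UNIV. \<Sum>k\<in>UNIV. (cmod (w $ j $ k))\<^sup>2 * r j powr \<alpha> * s (snd k) powr (1 - \<alpha>))"

lemma alpha_expr_eq_overlap_sum:
  assumes U: "unitary U" and V: "unitary V"
    and w: "w = cadjoint U ** tensor (mat 1) V"
  shows "alpha_expr \<alpha> (U ** diag_real r ** cadjoint U) (V ** diag_real s ** cadjoint V)
    = 1 / (1 - \<alpha>) * log 2 (overlap_sum \<alpha> w r s)"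
  unfolding alpha_expr_def mat_powr_def herm_fun_eqI[OF U refl]
    herm_fun_eqI[OF unitary_tensor_1[OF V] tensor_1_conjugate]
    trace_conjugate_diag_real_mult[OF w] overlap_sum_def ..

lemma overlap_sum_ge_term:
  fixes w :: "('a::finite \<times> 'b::finite) cmatrix"
  shows "(cmod (w $ j $ k))\<^sup>2 * r j powr \<alpha> * s (snd k) powr (1 - \<alpha>) \<le> overlap_sum \<alpha> w r s"
proof -
  let ?t = "\<lambda>j k. (cmod (w $ j $ k))\<^sup>2 * r j powr \<alpha> * s (snd k) powr (1 - \<alpha>)"
  have "?t j k \<le> (\<Sum>k\<in>UNIV. ?t j k)" by (rule member_le_sum) auto
  also have "\<dots> \<le> (\<Sum>j\<in>UNIV. \<Sum>k\<in>UNIV. ?t j k)"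
    by (rule member_le_sum[of j UNIV "\<lambda>j. \<Sum>k\<in>UNIV. ?t j k"]) (auto intro: sum_nonneg)
  finally show ?thesis by (simp add: overlap_sum_def)
qed

text \<open>A row of a unitary matrix has norm 1, hence a nonzero entry, and its term is positive.
  This makes the logarithm of the sum meaningful.\<close>

lemma overlap_sum_pos:
  fixes w :: "('a::finite \<times> 'b::finite) cmatrix"
  assumes w: "unitary w" and j: "0 < r j"
    and supp: "\<And>k. w $ j $ k \<noteq> 0 \<Longrightarrow> 0 < s (snd k)"
  shows "0 < overlap_sum \<alpha> w r s"
proof -
  have "(w ** cadjoint w) $ j $ j = 1" using w by (simp add: unitary_self mat_def)
  then have "(\<Sum>k\<in>UNIV. w $ j $ k * cnj (w $ j $ k)) \<noteq> 0"
    by (simp add: matrix_matrix_mult_def)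
  then obtain k where "w $ j $ k * cnj (w $ j $ k) \<noteq> 0"
    by (rule sum.not_neutral_contains_not_neutral)
  then have k: "w $ j $ k \<noteq> 0" by auto
  have "0 < (cmod (w $ j $ k))\<^sup>2 * r j powr \<alpha> * s (snd k) powr (1 - \<alpha>)"
    using k j supp[OF k] by simp
  then show ?thesis using overlap_sum_ge_term less_le_trans by blast
qed

lemma invertible_conjugate_diag_real:
  assumes V: "unitary V" and inv: "invertible (V ** diag_real s ** cadjoint V)"
  shows "s i \<noteq> 0"
proof -
  obtain X where X: "X ** (V ** diag_real s ** cadjoint V) = mat 1"
    using inv by (auto simp: invertible_def)
  have "(cadjoint V ** X ** V) ** diag_real s
      = cadjoint V ** (X ** (V ** diag_real s ** cadjoint V)) ** V"
    using V by (simp add: matrix_mul_assoc[symmetric] unitary_self)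
  also have "\<dots> = mat 1" using V by (simp add: X unitary_self)
  finally have "((cadjoint V ** X ** V) ** diag_real s) $ i $ i = 1" by (simp add: mat_def)
  then show ?thesis by (auto simp: matrix_diag_real_nth)
qed

text \<open>\<open>powr\<close> with a negative exponent jumps at 0, but by the support condition
  terms with \<open>s (snd k) = 0\<close> have weight 0.\<close>

lemma tendsto_overlap_sum:
  fixes w :: "('a::finite \<times> 'b::finite) cmatrix"
  assumes supp: "\<And>j k. w $ j $ k \<noteq> 0 \<Longrightarrow> r j \<noteq> 0 \<Longrightarrow> s (snd k) \<noteq> 0"
  shows "((\<lambda>\<xi>. overlap_sum \<alpha> w r (\<lambda>i. s i + \<xi>)) \<longlongrightarrow> overlap_sum \<alpha> w r s) (at_right 0)"
  unfolding overlap_sum_def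
proof (intro tendsto_sum)
  fix j k
  show "((\<lambda>\<xi>. (cmod (w $ j $ k))\<^sup>2 * r j powr \<alpha> * (s (snd k) + \<xi>) powr (1 - \<alpha>))
      \<longlongrightarrow> (cmod (w $ j $ k))\<^sup>2 * r j powr \<alpha> * s (snd k) powr (1 - \<alpha>)) (at_right 0)"
  proof (cases "w $ j $ k = 0 \<or> r j = 0")
    case True
    then show ?thesis by auto
  next
    case False
    have "((\<lambda>\<xi>. s (snd k) + \<xi>) \<longlongrightarrow> s (snd k) + 0) (at_right 0)"
      by (intro tendsto_intros)
    then have "((\<lambda>\<xi>. s (snd k) + \<xi>) \<longlongrightarrow> s (snd k)) (at_right 0)" by simp
    moreover have "s (snd k) \<noteq> 0" using False supp by blast
    ultimately show ?thesis by (intro tendsto_intros) auto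
  qed
qed

text \<open>A single term of order \<open>\<xi> powr (1 - \<alpha>)\<close> bounds the sum from
  below; the negative factor \<open>1 / (1 - \<alpha>)\<close> turns this into an upper bound by a
  constant plus \<open>log 2 \<xi>\<close>.\<close>

lemma log_overlap_sum_tendsto_minus_infinity:
  fixes w :: "('a::finite \<times> 'b::finite) cmatrix"
  assumes \<alpha>: "1 < \<alpha>" and w: "w $ j $ k \<noteq> 0" and r: "0 < r j" and s: "s (snd k) = 0"
  shows "((\<lambda>\<xi>. ereal (1 / (1 - \<alpha>) * log 2 (overlap_sum \<alpha> w r (\<lambda>i. s i + \<xi>)))) \<longlongrightarrow> - \<infinity>) (at_right 0)"
proof -
  define c where "c = (cmod (w $ j $ k))\<^sup>2 * r j powr \<alpha>"
  have c: "0 < c" using w r by (simp add: c_def)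
  have le: "1 / (1 - \<alpha>) * log 2 (overlap_sum \<alpha> w r (\<lambda>i. s i + \<xi>)) \<le> log 2 c / (1 - \<alpha>) + log 2 \<xi>"
    if \<xi>: "0 < \<xi>" for \<xi>
  proof -
    have "c * \<xi> powr (1 - \<alpha>) \<le> overlap_sum \<alpha> w r (\<lambda>i. s i + \<xi>)"
      using overlap_sum_ge_term[of w j k r \<alpha> "\<lambda>i. s i + \<xi>"] by (simp add: c_def s)
    moreover have "0 < c * \<xi> powr (1 - \<alpha>)" using c \<xi> by simp
    ultimately have "log 2 (c * \<xi> powr (1 - \<alpha>)) \<le> log 2 (overlap_sum \<alpha> w r (\<lambda>i. s i + \<xi>))"
      by simp
    then have "1 / (1 - \<alpha>) * log 2 (overlap_sum \<alpha> w r (\<lambda>i. s i + \<xi>))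
        \<le> 1 / (1 - \<alpha>) * log 2 (c * \<xi> powr (1 - \<alpha>))"
      using \<alpha> by (intro mult_left_mono_neg) auto
    also have "\<dots> = log 2 c / (1 - \<alpha>) + log 2 \<xi>"
      using c \<xi> \<alpha> by (simp add: log_mult log_powr field_simps)
    finally show ?thesis .
  qed
  show ?thesis
    unfolding tendsto_MInfty
  proof
    fix x :: real
    have "filterlim (\<lambda>\<xi>. ln \<xi>) at_bot (at_right (0::real))" by (rule ln_at_0)
    then have "\<forall>\<^sub>F \<xi> in at_right 0. ln \<xi> < (x - log 2 c / (1 - \<alpha>)) * ln 2"
      by (simp add: filterlim_at_bot_dense)
    moreover have "\<forall>\<^sub>F \<xi> in at_right 0. (0::real) < \<xi>" by (rule eventually_at_right_less)
    ultimately show "\<forall>\<^sub>F \<xi> in at_right 0.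
        ereal (1 / (1 - \<alpha>) * log 2 (overlap_sum \<alpha> w r (\<lambda>i. s i + \<xi>))) < ereal x"
    proof eventually_elim
      case (elim \<xi>)
      have "log 2 \<xi> < x - log 2 c / (1 - \<alpha>)"
        using elim(1) by (simp add: log_def divide_less_eq)
      then show ?case using le[OF elim(2)] by simp
    qed
  qed
qed

text \<open>With \<open>B = 2\<^sup>-\<^sup>\<lambda> (1 \<otimes> \<sigma>)\<close>, the value of \<open>\<lambda>\<close> makes \<open>tr (\<rho>\<^sup>\<alpha> B\<^sup>1\<^sup>-\<^sup>\<alpha>) = \<epsilon>\<^sup>2 / 2\<close>.\<close>
lemma smooth_min_entropy_ge_overlap_sum:
  fixes \<rho> :: "('a::finite \<times> 'b::finite) cmatrix"
  assumes \<rho>: "\<rho> \<in> states" and U: "unitary U" and \<rho>d: "\<rho> = U ** diag_real r ** cadjoint U"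
    and V: "unitary V" and \<sigma>d: "\<sigma> = V ** diag_real s ** cadjoint V"
    and w: "w = cadjoint U ** tensor (mat 1) V"
    and r: "\<And>j. 0 \<le> r j" and s: "\<And>i. 0 \<le> s i"
    and supp: "\<And>j k. w $ j $ k \<noteq> 0 \<Longrightarrow> 0 < r j \<Longrightarrow> 0 < s (snd k)"
    and \<epsilon>: "0 < \<epsilon>" and \<alpha>: "1 < \<alpha>" "\<alpha> \<le> 2" and pos: "0 < overlap_sum \<alpha> w r s"
  shows "ereal (1 / (1 - \<alpha>) * log 2 (overlap_sum \<alpha> w r s) - 1 / (\<alpha> - 1) * log 2 (2 / \<epsilon>\<^sup>2))
    \<le> smooth_min_entropy \<epsilon> \<rho> \<sigma>"
proof -
  define q where "q = overlap_sum \<alpha> w r s"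
  define l where "l = 1 / (1 - \<alpha>) * log 2 q - 1 / (\<alpha> - 1) * log 2 (2 / \<epsilon>\<^sup>2)"
  define W :: "('a \<times> 'b) cmatrix" where "W = tensor (mat 1) V"
  have W: "unitary W" unfolding W_def by (rule unitary_tensor_1[OF V])
  define B where "B = (2 powr (- l)) *\<^sub>R tensor (mat 1 :: 'a cmatrix) \<sigma>"
  let ?b = "\<lambda>k. 2 powr (- l) * s (snd k)"
  have Bd: "B = W ** diag_real ?b ** cadjoint W"
    unfolding B_def \<sigma>d tensor_1_conjugate W_def
    by (simp add: matrix_scaleR_left matrix_scaleR_right flip: diag_real_scaleR)
  have \<sigma>: "psd \<sigma>" unfolding \<sigma>d by (rule psd_conjugate_diag_real) (rule s)
  have "1 / (1 - \<alpha>) * x * (\<alpha> - 1) = - x" "1 / (\<alpha> - 1) * x * (\<alpha> - 1) = x" for x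
    using \<alpha> by (simp_all add: field_simps)
  then have "l * (\<alpha> - 1) = - log 2 q - log 2 (2 / \<epsilon>\<^sup>2)"
    unfolding l_def left_diff_distrib by (simp only:)
  then have "2 powr (l * (\<alpha> - 1)) = 2 powr (- log 2 q) * 2 powr (- log 2 (2 / \<epsilon>\<^sup>2))"
    by (simp flip: powr_add)
  also have "\<dots> = \<epsilon>\<^sup>2 / (2 * q)"
    using pos \<epsilon> by (simp add: powr_minus q_def field_simps)
  finally have scale: "2 powr (l * (\<alpha> - 1)) * q = \<epsilon>\<^sup>2 / 2"
    using pos by (simp add: q_def)
  have b_powr: "?b k powr (1 - \<alpha>) = 2 powr (l * (\<alpha> - 1)) * s (snd k) powr (1 - \<alpha>)" for k
    using s by (simp add: powr_mult powr_powr algebra_simps)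
  have sum: "(\<Sum>j\<in>UNIV. \<Sum>k\<in>UNIV. (cmod (w $ j $ k))\<^sup>2 * r j powr \<alpha> * ?b k powr (1 - \<alpha>)) = \<epsilon>\<^sup>2 / 2"
    unfolding scale[symmetric] q_def overlap_sum_def b_powr
    by (simp add: sum_distrib_left mult_ac)
  have "psd B" unfolding B_def using \<sigma> by (intro psd_scaleR psd_tensor_1) auto
  moreover have "Re (trace (P ** (\<rho> - B))) \<le> \<epsilon>\<^sup>2 / 2" if "cadjoint P = P" "P ** P = P" for P
    unfolding \<rho>d Bd sum[symmetric]
    by (rule trace_projection_le_powr[OF U W]) (use w W_def r s supp \<alpha> that in auto)
  ultimately obtain \<tau> where \<tau>: "\<tau> \<in> eps_ball \<epsilon> \<rho>" "psd (B - \<tau>)"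
    using eps_ball_below[OF \<rho>] \<epsilon> by (metis less_imp_le)
  have "ereal l \<le> min_entropy \<tau> \<sigma>"
    unfolding min_entropy_def using \<tau>(2) by (intro Sup_upper) (auto simp: loewner_le_def B_def)
  also have "\<dots> \<le> smooth_min_entropy \<epsilon> \<rho> \<sigma>"
    using \<rho> \<sigma> \<epsilon> \<tau>(1) by (intro min_entropy_le_smooth_min_entropy) (auto simp: states_def)
  finally show ?thesis by (simp add: l_def q_def)
qed

theorem theorem7:
  fixes \<rho> :: "('a::finite \<times> 'b::finite) cmatrix" and \<sigma> :: "'b cmatrix"
    and \<epsilon> \<alpha> :: real
  assumes "\<rho> \<in> states" and "\<sigma> \<in> states" and "\<epsilon> > 0" and "1 < \<alpha>" and "\<alpha> \<le> 2"
  shows "smooth_min_entropy \<epsilon> \<rho> \<sigma> \<ge>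
    alpha_entropy \<alpha> \<rho> \<sigma> - ereal (1 / (\<alpha> - 1) * log 2 (2 / \<epsilon>\<^sup>2))"
proof -
  obtain U r where U: "unitary U" and \<rho>: "\<rho> = U ** diag_real r ** cadjoint U" and r: "\<And>j. 0 \<le> r j"
    using psd_spectral[of \<rho>] assms(1) by (auto simp: states_def)
  obtain V s where V: "unitary V" and \<sigma>: "\<sigma> = V ** diag_real s ** cadjoint V" and s: "\<And>i. 0 \<le> s i"
    using psd_spectral[of \<sigma>] assms(2) by (auto simp: states_def)
  define w where "w = cadjoint U ** tensor (mat 1) V"
  have w: "unitary w"
    unfolding w_def by (intro unitary_mult unitary_cadjoint U unitary_tensor_1 V)
  \<comment> \<open>Adding a multiple of the identity shifts the spectrum of \<sigma> and keeps its
    eigenvectors, hence also the overlaps \<open>w\<close>.\<close>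
  have expr: "alpha_expr \<alpha> \<rho> (\<sigma> + \<xi> *\<^sub>R mat 1)
      = 1 / (1 - \<alpha>) * log 2 (overlap_sum \<alpha> w r (\<lambda>i. s i + \<xi>))" for \<xi>
  proof -
    have d: "diag_real (\<lambda>i. \<xi>) = \<xi> *\<^sub>R (mat 1 :: 'b cmatrix)"
      by (rule sym) (use diag_real_scaleR[of \<xi> "\<lambda>i. 1"] in \<open>simp add: diag_real_1\<close>)
    have "\<xi> *\<^sub>R mat 1 = V ** diag_real (\<lambda>i. \<xi>) ** cadjoint V"
      using V by (simp add: matrix_scaleR_left matrix_scaleR_right unitary_self d)
    then have "\<sigma> + \<xi> *\<^sub>R mat 1 = V ** diag_real (\<lambda>i. s i + \<xi>) ** cadjoint V"
      by (simp add: \<sigma> matrix_distribs flip: diag_real_add)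
    then show ?thesis using alpha_expr_eq_overlap_sum[OF U V w_def] by (simp add: \<rho>)
  qed
  show ?thesis
  \<comment> \<open>The first case is a failure of the support condition: an eigenvector of \<rho>
    with positive eigenvalue meets the kernel of \<open>tensor (mat 1) \<sigma>\<close>. The entropy
    is then minus infinity.\<close>
  proof (cases "\<exists>j k. w $ j $ k \<noteq> 0 \<and> 0 < r j \<and> s (snd k) = 0")
    case True
    then obtain j k where jk: "w $ j $ k \<noteq> 0" "0 < r j" "s (snd k) = 0" by blast
    have "\<not> invertible \<sigma>"
      using invertible_conjugate_diag_real[OF V] jk(3) \<sigma> by blast
    then have "alpha_entropy \<alpha> \<rho> \<sigma> = - \<infinity>"
      using tendsto_Lim[OF _ log_overlap_sum_tendsto_minus_infinity
          [where w = w and j = j and k = k and r = r and s = s, OF assms(4) jk]]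
      by (simp add: alpha_entropy_def expr)
    then show ?thesis by simp
  next
    case False
    then have supp: "w $ j $ k \<noteq> 0 \<Longrightarrow> 0 < r j \<Longrightarrow> 0 < s (snd k)" for j k
      using s by (metis less_eq_real_def)
    have "\<exists>j. 0 < r j"
    proof (rule ccontr)
      assume "\<not> (\<exists>j. 0 < r j)"
      then have "r = (\<lambda>_. 0)" using r by (metis less_eq_real_def)
      then have "trace (diag_real r ** (cadjoint U ** U)) = 0"
        by (simp add: trace_diag_mult)
      then have "trace \<rho> = 0"
        unfolding \<rho> by (metis matrix_mul_assoc trace_rotate)
      then show False using assms(1) by (simp add: states_def)
    qed
    then have pos: "0 < overlap_sum \<alpha> w r s"
      using overlap_sum_pos[OF w] supp by metis
    have "alpha_entropy \<alpha> \<rho> \<sigma> = ereal (1 / (1 - \<alpha>) * log 2 (overlap_sum \<alpha> w r s))"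
    proof (cases "invertible \<sigma>")
      case True
      then show ?thesis using expr[of 0] by (simp add: alpha_entropy_def)
    next
      case False
      \<comment> \<open>Here \<sigma> is singular but its support suffices, so the regularised sums
        converge to the sum at \<sigma> itself.\<close>
      have "((\<lambda>\<xi>. overlap_sum \<alpha> w r (\<lambda>i. s i + \<xi>)) \<longlongrightarrow> overlap_sum \<alpha> w r s) (at_right 0)"
        using supp r by (intro tendsto_overlap_sum) (metis less_eq_real_def less_irrefl)
      then have "((\<lambda>\<xi>. ereal (alpha_expr \<alpha> \<rho> (\<sigma> + \<xi> *\<^sub>R mat 1)))
          \<longlongrightarrow> ereal (1 / (1 - \<alpha>) * log 2 (overlap_sum \<alpha> w r s))) (at_right 0)"
        unfolding expr using pos by (intro tendsto_intros) auto
      then show ?thesis using False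
        by (simp add: alpha_entropy_def tendsto_Lim)
    qed
    then show ?thesis
      using smooth_min_entropy_ge_overlap_sum[OF assms(1) U \<rho> V \<sigma> w_def r s supp assms(3-5) pos]
      by simp
  qed
qed

end
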